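(* Consider any finite-state channel with time-invariant deterministic feedback $z_i=z(y_i)$, and let $F_\infty(\rho)=\sup_{N\ge 1}F_N(\rho)$ and $\underline{C}=\lim_{N\to\infty}\underline{C}_N$ be as defined in the context. For a rate $R\ge 0$ let $$E_r(R)=\max_{0\le\rho\le 1}\left[F_\infty(\rho)-\rho R\right].$$ Then for any $\epsilon>0$ there exists $N(\epsilon)$ such that for every $N\ge N(\epsilon)$ there exists an $(N,M)$ code with $M=\lceil 2^{NR}\rceil$ such that for all messages $m$, $1\le m\le M$, and all initial states $s_0$, $$P_{e,m}(s_0)\le 2^{-N[E_r(R)-\epsilon]}.$$ Furthermore, for $0\le R<\underline{C}$, $E_r(R)$ is strictly positive (and therefore the error probability can be made arbitrarily small for $N$ large enough).
   Context: Finite-state channel (FSC): finite input, output and state alphabets $\mathcal X,\mathcal Y,\mathcal S$ and a time-invariant kernel $P(y_i,s_i|x_i,s_{i-1})$ with $P(y_i,s_i|x^i,s^{i-1},y^{i-1})=P(y_i,s_i|x_i,s_{i-1})$; $s_0$ is the initial state. Notation: $x^i=(x_1,\dots,x_i)$. All logarithms are to base 2. Feedback: $z:\mathcal Y\to\mathcal Z$ is a fixed function into a finite set, $z_i=z(y_i)$, and at time $i$ the encoder knows $z^{i-1}$. In any expression involving both $y^N$ and $z^{N-1}$, $z^{N-1}=(z(y_1),\dots,z(y_{N-1}))$. An $(N,M)$ code consists of encoding functions $x_i(m,z^{i-1})$, $i=1,\dots,N$, for messages $m\in\{1,\dots,M\}$, and a decoder $\hat m(y^N)$. $P_{e,m}(s_0)$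 is the probability that $\hat m(Y^N)\ne m$ when message $m$ is sent and the initial state is $s_0$. Causal conditioning: $Q(x^N\|z^{N-1})=\prod_{i=1}^N Q(x_i|x^{i-1},z^{i-1})$, where the factors are arbitrary conditional probability mass functions (maxima over $Q(x^N\|z^{N-1})$ are over all such families); $P(y^N\|x^N,s_0)=\prod_{i=1}^N P(y_i|x^i,y^{i-1},s_0)=\sum_{s^N}\prod_{i=1}^N P(y_i,s_i|x_i,s_{i-1})$. Given $Q$ and $s_0$, the joint law is $P(x^N,y^N|s_0)=Q(x^N\|z^{N-1})P(y^N\|x^N,s_0)$, and $I(X^N\to Y^N|s_0)=\sum_{i=1}^N I(X^i;Y_i|Y^{i-1},S_0=s_0)$ under this law. Define $$E_{o,N}(\rho,Q(x^N\|z^{N-1}),s_0)=-\frac1N\log\sum_{y^N}\left[\sum_{x^N}Q(x^N\|z^{N-1})P(y^N\|x^N,s_0)^{\frac1{1+\rho}}\right]^{1+\rho},$$ $$F_N(\rho)=-\frac{\rho\log|\mathcal S|}{N}+\max_{Q(x^N\|z^{N-1})}\left[\min_{s_0}E_{o,N}(\rho,Q(x^N\|z^{N-1}),s_0)\right],$$ $$\underline C_N=\frac1N\max_{Q(x^N\|z^{N-1})}\min_{s_0}I(X^N\to Y^N|s_0),$$ and $\underline C=\lim_{N\to\infty}\underline C_N$ (this limit exists). *)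

theory Defs
  imports "HOL-Probability.Probability"
begin

text \<open>
  The kernel \<open>W x s\<close> is the law of (output, next state) given input \<open>x\<close> and current state \<open>s\<close>.
  Sequences are lists and are indexed from 0, so the component \<open>i\<close> of the
  mathematical notation is \<open>xs ! (i - 1)\<close>, and \<open>take i xs\<close> is its prefix of length \<open>i\<close>.
  The alphabets are finite types.
\<close>

type_synonym ('x, 'y, 's) kernel = "'x \<Rightarrow> 's \<Rightarrow> ('y \<times> 's) pmf"

text \<open>
  A causally conditioned input law is a family of conditional mass functions: \<open>q xs zs\<close> is the
  law of the next input given past inputs \<open>xs\<close> and past feedback \<open>zs\<close>, the time index
  being \<open>length xs + 1\<close>.
\<close>

type_synonym ('x, 'z) causal_input = "'x list \<Rightarrow> 'z list \<Rightarrow> 'x pmf"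

definition causal_prob :: "('x, 'z) causal_input \<Rightarrow> 'x list \<Rightarrow> 'z list \<Rightarrow> real" where
  "causal_prob q xs zs = (\<Prod>i<length xs. pmf (q (take i xs) (take i zs)) (xs ! i))"

definition path_prob :: "('x, 'y, 's) kernel \<Rightarrow> 's \<Rightarrow> 'x list \<Rightarrow> 'y list \<Rightarrow> 's list \<Rightarrow> real" where
  "path_prob W s0 xs ys ss =
     (\<Prod>i<length xs. pmf (W (xs ! i) ((s0 # ss) ! i)) (ys ! i, ss ! i))"

definition channel_prob ::
    "('x, 'y, 's::finite) kernel \<Rightarrow> 's \<Rightarrow> 'x list \<Rightarrow> 'y list \<Rightarrow> real" where
  "channel_prob W s0 xs ys = (\<Sum>ss | length ss = length xs. path_prob W s0 xs ys ss)"

text \<open>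
  The process generated by the channel, with deterministic feedback \<open>z\<close>, up to a given time:
  inputs, outputs and states \<open>s\<^sub>1, s\<^sub>2, \<dots>\<close>.
\<close>

primrec fsc_run :: "('x, 'y, 's) kernel \<Rightarrow> ('y \<Rightarrow> 'z) \<Rightarrow> ('x, 'z) causal_input \<Rightarrow> 's \<Rightarrow> nat
    \<Rightarrow> ('x list \<times> 'y list \<times> 's list) pmf" where
  "fsc_run W z q s0 0 = return_pmf ([], [], [])"
| "fsc_run W z q s0 (Suc n) =
     do {
       (xs, ys, ss) \<leftarrow> fsc_run W z q s0 n;
       x \<leftarrow> q xs (map z ys);
       (y, s) \<leftarrow> W x (last (s0 # ss));
       return_pmf (xs @ [x], ys @ [y], ss @ [s])
     }"

definition joint_law :: "('x, 'y, 's) kernel \<Rightarrow> ('y \<Rightarrow> 'z) \<Rightarrow> ('x, 'z) causal_input \<Rightarrow> 's \<Rightarrow> nat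
    \<Rightarrow> ('x list \<times> 'y list) pmf" where
  "joint_law W z q s0 N = map_pmf (\<lambda>(xs, ys, ss). (xs, ys)) (fsc_run W z q s0 N)"

lemma fsc_run_lengths:
  assumes "(xs, ys, ss) \<in> set_pmf (fsc_run W z q s0 n)"
  shows "length xs = n \<and> length ys = n \<and> length ss = n"
  using assms by (induction n arbitrary: xs ys ss) auto

lemma pmf_bind_snoc3:
  "pmf (do {(y, s) \<leftarrow> p; return_pmf (xs' @ [x'], ys' @ [y], ss' @ [s])}) (xs @ [x], ys @ [y0], ss @ [t]) =
     (if xs' = xs \<and> x' = x \<and> ys' = ys \<and> ss' = ss then pmf p (y0, t) else 0)"
proof -
  have "do {(y, s) \<leftarrow> p; return_pmf (xs' @ [x'], ys' @ [y], ss' @ [s])} =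
        map_pmf (\<lambda>(y, s). (xs' @ [x'], ys' @ [y], ss' @ [s])) p"
    by (simp add: map_pmf_def case_prod_beta')
  moreover have "pmf (map_pmf (\<lambda>(y, s). (xs' @ [x'], ys' @ [y], ss' @ [s])) p) (xs @ [x], ys @ [y0], ss @ [t]) =
     (if xs' = xs \<and> x' = x \<and> ys' = ys \<and> ss' = ss then pmf p (y0, t) else 0)"
  proof (cases "xs' = xs \<and> x' = x \<and> ys' = ys \<and> ss' = ss")
    case True
    have "inj (\<lambda>(y, s). (xs' @ [x'], ys' @ [y], ss' @ [s]))"
      by (auto simp: inj_def)
    from pmf_map_inj'[OF this, of p "(y0, t)"] True show ?thesis by simp
  next
    case False
    then show ?thesis by (auto simp: pmf_eq_0_set_pmf)
  qed
  ultimately show ?thesis by simp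
qed

lemma pmf_fsc_run_Suc:
  "pmf (fsc_run W z q s0 (Suc n)) (xs @ [x], ys @ [y], ss @ [s]) =
     pmf (fsc_run W z q s0 n) (xs, ys, ss) * pmf (q xs (map z ys)) x * pmf (W x (last (s0 # ss))) (y, s)"
proof -
  define g where "g = (\<lambda>(xs', ys', ss'). do {
       x \<leftarrow> q xs' (map z ys');
       (y, s) \<leftarrow> W x (last (s0 # ss'));
       return_pmf (xs' @ [x], ys' @ [y], ss' @ [s])
     })"
  have inner: "pmf (g w) (xs @ [x], ys @ [y], ss @ [s]) =
      (if w = (xs, ys, ss) then pmf (q xs (map z ys)) x * pmf (W x (last (s0 # ss))) (y, s) else 0)" for w
  proof -
    obtain xs' ys' ss' where w: "w = (xs', ys', ss')" by (cases w)
    have "pmf (g w) (xs @ [x], ys @ [y], ss @ [s]) =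
        (\<integral>x'. (if xs' = xs \<and> x' = x \<and> ys' = ys \<and> ss' = ss
           then pmf (W x' (last (s0 # ss'))) (y, s) else 0) \<partial>measure_pmf (q xs' (map z ys')))"
      unfolding g_def w by (simp only: prod.case pmf_bind[of "q xs' (map z ys')"] pmf_bind_snoc3)
    also have "\<dots> = (if w = (xs, ys, ss) then pmf (q xs (map z ys)) x * pmf (W x (last (s0 # ss))) (y, s) else 0)"
    proof (cases "w = (xs, ys, ss)")
      case True
      then show ?thesis
        using w by (subst integral_measure_pmf_real[where A = "{x}"]) (auto simp: mult.commute split: if_splits)
    next
      case False
      then have "\<not> (xs' = xs \<and> x' = x \<and> ys' = ys \<and> ss' = ss)" for x'
        using w by auto
      then have "(\<lambda>x'. (if xs' = xs \<and> x' = x \<and> ys' = ys \<and> ss' = ss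
           then pmf (W x' (last (s0 # ss'))) (y, s) else 0)) = (\<lambda>_. 0)"
        by (auto simp: fun_eq_iff)
      then show ?thesis using False by simp
    qed
    finally show ?thesis .
  qed
  have "pmf (fsc_run W z q s0 (Suc n)) (xs @ [x], ys @ [y], ss @ [s]) =
      (\<integral>w. pmf (g w) (xs @ [x], ys @ [y], ss @ [s]) \<partial>measure_pmf (fsc_run W z q s0 n))"
    by (simp add: pmf_bind g_def)
  also have "\<dots> = pmf (fsc_run W z q s0 n) (xs, ys, ss) * (pmf (q xs (map z ys)) x * pmf (W x (last (s0 # ss))) (y, s))"
    unfolding inner
    by (subst integral_measure_pmf_real[where A = "{(xs, ys, ss)}"]) (auto simp: mult.commute split: if_splits)
  finally show ?thesis by (simp add: mult.assoc)
qed

lemma causal_prob_snoc: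
  "length zs = length xs \<Longrightarrow>
     causal_prob q (xs @ [x]) (zs @ [u]) = causal_prob q xs zs * pmf (q xs zs) x"
  by (simp add: causal_prob_def nth_append)

lemma path_prob_snoc:
  assumes "length ys = length xs" "length ss = length xs"
  shows "path_prob W s0 (xs @ [x]) (ys @ [y]) (ss @ [s]) =
           path_prob W s0 xs ys ss * pmf (W x (last (s0 # ss))) (y, s)"
proof -
  have "(s0 # ss @ [s]) ! i = (s0 # ss) ! i" if "i \<le> length ss" for i
    using that by (cases i) (auto simp: nth_append)
  moreover have "(s0 # ss) ! length ss = last (s0 # ss)"
    by (simp add: last_conv_nth)
  ultimately show ?thesis using assms
    by (simp add: path_prob_def nth_append)
qed

lemma pmf_fsc_run:
  assumes "length xs = n" "length ys = n" "length ss = n"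
  shows "pmf (fsc_run W z q s0 n) (xs, ys, ss) =
           causal_prob q xs (map z ys) * path_prob W s0 xs ys ss"
  using assms
proof (induction n arbitrary: xs ys ss)
  case 0
  then show ?case by (simp add: causal_prob_def path_prob_def)
next
  case (Suc n)
  obtain xs' x where xs: "xs = xs' @ [x]" "length xs' = n"
    using Suc.prems(1) by (metis append_butlast_last_id length_butlast diff_Suc_1 list.size(3) nat.distinct(1))
  obtain ys' y where ys: "ys = ys' @ [y]" "length ys' = n"
    using Suc.prems(2) by (metis append_butlast_last_id length_butlast diff_Suc_1 list.size(3) nat.distinct(1))
  obtain ss' s where ss: "ss = ss' @ [s]" "length ss' = n"
    using Suc.prems(3) by (metis append_butlast_last_id length_butlast diff_Suc_1 list.size(3) nat.distinct(1))
  show ?case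
    unfolding xs(1) ys(1) ss(1) pmf_fsc_run_Suc
    using xs ys ss Suc.IH[of xs' ys' ss'] by (simp add: causal_prob_snoc path_prob_snoc)
qed

text \<open>The joint law of inputs and outputs is the product of causally conditioned laws.\<close>

lemma pmf_joint_law:
  fixes W :: "('x, 'y, 's::finite) kernel"
  shows "pmf (joint_law W z q s0 N) (xs, ys) =
    (if length xs = N \<and> length ys = N
     then causal_prob q xs (map z ys) * channel_prob W s0 xs ys else 0)"
proof (cases "length xs = N \<and> length ys = N")
  case True
  let ?R = "fsc_run W z q s0 N" and ?A = "(\<lambda>ss. (xs, ys, ss)) ` {ss. length ss = N}"
  have fin: "finite {ss :: 's list. length ss = N}"
    using finite_lists_length_eq[of "UNIV :: 's set" N] by simp
  have "pmf (joint_law W z q s0 N) (xs, ys) =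
      measure_pmf.prob ?R ((\<lambda>(xs, ys, ss). (xs, ys)) -` {(xs, ys)})"
    by (simp add: joint_law_def pmf_map)
  also have "\<dots> = measure_pmf.prob ?R ?A"
    by (intro measure_pmf.finite_measure_eq_AE) (auto simp: AE_measure_pmf_iff dest: fsc_run_lengths)
  also have "\<dots> = (\<Sum>w\<in>?A. pmf ?R w)"
    using fin by (simp add: measure_measure_pmf_finite)
  also have "\<dots> = (\<Sum>ss | length ss = N. pmf ?R (xs, ys, ss))"
    by (subst sum.reindex) (auto simp: inj_on_def)
  also have "\<dots> = causal_prob q xs (map z ys) * channel_prob W s0 xs ys"
    using True by (simp add: pmf_fsc_run channel_prob_def sum_distrib_left)
  finally show ?thesis using True by simp
next
  case False
  then have "(xs, ys) \<notin> set_pmf (joint_law W z q s0 N)"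
    by (auto simp: joint_law_def dest: fsc_run_lengths)
  then show ?thesis unfolding if_not_P[OF False] by (simp add: set_pmf_iff)
qed

definition cond_mutual_info ::
    "'a pmf \<Rightarrow> ('a \<Rightarrow> 'b) \<Rightarrow> ('a \<Rightarrow> 'c) \<Rightarrow> ('a \<Rightarrow> 'd) \<Rightarrow> real" where
  "cond_mutual_info p X Y U =
     prob_space.conditional_mutual_information (measure_pmf p) 2
       (count_space (range X)) (count_space (range Y)) (count_space (range U)) X Y U"

definition directed_info :: "('x, 'y, 's) kernel \<Rightarrow> ('y \<Rightarrow> 'z) \<Rightarrow> nat
    \<Rightarrow> ('x, 'z) causal_input \<Rightarrow> 's \<Rightarrow> real" where
  "directed_info W z N q s0 =
     (\<Sum>i=1..N. cond_mutual_info (joint_law W z q s0 N)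
        (\<lambda>(xs, ys). take i xs) (\<lambda>(xs, ys). ys ! (i - 1)) (\<lambda>(xs, ys). take (i - 1) ys))"

text \<open>
  Only the values of \<open>q\<close> on lists shorter than \<open>N\<close> matter below, so each maximum over \<open>q\<close> is one of a
  continuous function on a finite product of simplices; it is written as a supremum, and so is the
  maximum of a continuous function over \<open>\<rho> \<in> {0..1}\<close> in \<open>E_r\<close>.
\<close>

definition C_lower_N :: "('x::finite, 'y::finite, 's::finite) kernel \<Rightarrow> ('y \<Rightarrow> 'z) \<Rightarrow> nat \<Rightarrow> real" where
  "C_lower_N W z N = (1 / real N) * (SUP q. MIN s0. directed_info W z N q s0)"

definition C_lower :: "('x::finite, 'y::finite, 's::finite) kernel \<Rightarrow> ('y \<Rightarrow> 'z) \<Rightarrow> real" where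
  "C_lower W z = lim (C_lower_N W z)"

definition E_o :: "('x::finite, 'y::finite, 's::finite) kernel \<Rightarrow> ('y \<Rightarrow> 'z) \<Rightarrow> nat
    \<Rightarrow> real \<Rightarrow> ('x, 'z) causal_input \<Rightarrow> 's \<Rightarrow> real" where
  "E_o W z N \<rho> q s0 = - (1 / real N) * log 2
     (\<Sum>ys | length ys = N.
        (\<Sum>xs | length xs = N.
           causal_prob q xs (map z ys) * channel_prob W s0 xs ys powr (1 / (1 + \<rho>)))
        powr (1 + \<rho>))"

definition F_N :: "('x::finite, 'y::finite, 's::finite) kernel \<Rightarrow> ('y \<Rightarrow> 'z) \<Rightarrow> nat \<Rightarrow> real \<Rightarrow> real" where
  "F_N W z N \<rho> = - (\<rho> * log 2 (real CARD('s)) / real N) + (SUP q. MIN s0. E_o W z N \<rho> q s0)"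

definition F_inf :: "('x::finite, 'y::finite, 's::finite) kernel \<Rightarrow> ('y \<Rightarrow> 'z) \<Rightarrow> real \<Rightarrow> real" where
  "F_inf W z \<rho> = (SUP N\<in>{1..}. F_N W z N \<rho>)"

definition E_r :: "('x::finite, 'y::finite, 's::finite) kernel \<Rightarrow> ('y \<Rightarrow> 'z) \<Rightarrow> real \<Rightarrow> real" where
  "E_r W z R = (SUP \<rho>\<in>{0..1}. F_inf W z \<rho> - \<rho> * R)"

definition num_messages :: "nat \<Rightarrow> real \<Rightarrow> nat" where
  "num_messages N R = nat \<lceil>2 powr (real N * R)\<rceil>"

definition is_decoder :: "nat \<Rightarrow> nat \<Rightarrow> ('y list \<Rightarrow> nat) \<Rightarrow> bool" where
  "is_decoder N M dec \<longleftrightarrow> (\<forall>ys. length ys = N \<longrightarrow> dec ys \<in> {1..M})"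

text \<open>
  \<open>enc i m zs\<close> is the input at time \<open>i\<close> for message \<open>m\<close> and past feedback \<open>zs\<close>, a list of length
  \<open>i - 1\<close>.
\<close>

definition error_prob :: "('x, 'y, 's) kernel \<Rightarrow> ('y \<Rightarrow> 'z) \<Rightarrow> nat
    \<Rightarrow> (nat \<Rightarrow> nat \<Rightarrow> 'z list \<Rightarrow> 'x) \<Rightarrow> ('y list \<Rightarrow> nat) \<Rightarrow> nat \<Rightarrow> 's \<Rightarrow> real" where
  "error_prob W z N enc dec m s0 =
     measure_pmf.prob (fsc_run W z (\<lambda>xs zs. return_pmf (enc (length zs + 1) m zs)) s0 N)
       {(xs, ys, ss). dec ys \<noteq> m}"

end

theory Submission
  imports Defs
begin

text \<open>
  Achievability is Gallager's random coding argument. A code tree is drawn by sampling each input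
  from \<open>q\<close> given the past inputs and the past feedback, so that along every output sequence the codeword has
  the causally conditioned law; decoding maximizes the likelihood summed over all initial
  states, and expurgation turns the average bound into one for every message. This gives the exponent
  \<open>F_N W z N \<rho> - \<rho> * R\<close> for every \<open>N\<close> and \<open>\<rho>\<close>. Concatenating input laws and
  conditioning on the intermediate state (Minkowski's inequality) shows that \<open>N * F_N W z N \<rho>\<close> is
  superadditive in \<open>N\<close>, so \<open>F_N\<close> converges to \<open>F_inf\<close>; a single near-optimal \<open>\<rho>\<close> suffices.

  For positivity, \<open>N * E_o W z N \<rho> q s0 / \<rho>\<close> is bounded by the directed information and tends to it
  as \<open>\<rho>\<close> decreases to 0. Dividing the concatenation inequality by \<open>\<rho>\<close> therefore yields
  superadditivity of \<open>N * C_lower_N W z N - log 2 CARD('s)\<close>, whence \<open>C_lower\<close> is the supremum of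
  \<open>C_lower_N W z N - log 2 CARD('s) / N\<close>. If \<open>R\<close> is smaller, then it is smaller than one of these
  terms, and a small \<open>\<rho>\<close> at that \<open>N\<close> makes the exponent positive.
\<close>

section \<open>Inequalities for finite sums\<close>

text \<open>Neither encoder nor decoder knows the initial state. Pulling a sum over states through
  the powers \<open>1 / (1 + \<rho>)\<close> and \<open>1 + \<rho>\<close> costs a factor
  \<open>CARD('s) powr \<rho>\<close>. The correction term in \<open>F_N\<close> pays for exactly
  one such loss. In the random coding bound it cancels the loss from the decoding metric. In the
  concatenation inequality it stands twice on the side of the two blocks and once on the side of the
  long block, and the difference is the loss at the block boundary. What survives is a constant
  factor \<open>8 * CARD('s)\<close>, absorbed by \<epsilon>. The other concern is the order of
  choices. The limit of \<open>E_o\<close> divided by \<rho> is used only at fixed block length and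
  fixed input law, so no uniformity in either is needed: \<rho> is chosen after them. For
  achievability \<rho> is fixed before the block length grows, so no uniformity of
  \<open>F_N\<close> in \<rho> is needed. Maxima are suprema here, hence near-maximizers with a
  slack, and the bound of \<open>E_o\<close> by \<open>\<rho> * log 2 (real CARD('y))\<close> keeps
  these suprema meaningful.\<close>

lemma powr_tangent_le:
  fixes t T r :: real
  assumes "t \<ge> 0" "T > 0" "r \<ge> 1"
  shows "T powr r + r * T powr (r - 1) * (t - T) \<le> t powr r"
proof (cases "t = 0")
  case True
  have "T * T powr (r - 1) = T powr r"
    using assms by (simp add: powr_mult_base)
  then have "T powr r + r * T powr (r - 1) * (t - T) = (1 - r) * T powr r"
    using True by (simp add: algebra_simps)
  then show ?thesis using assms True by (simp add: mult_nonpos_nonneg)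
next
  case False
  \<comment> \<open>Young's inequality for \<open>t powr r\<close> and \<open>T powr r\<close> with
    weights 1/r and 1 - 1/r; multiplied by r it is the tangent inequality.\<close>
  have "(t powr r) powr (1 / r) * (T powr r) powr ((r - 1) / r)
      \<le> 1 / r * t powr r + (r - 1) / r * T powr r"
    using assms False by (intro Youngs_inequality_0) (auto simp: diff_divide_distrib)
  also have "(t powr r) powr (1 / r) = t"
    using assms by (simp add: powr_powr)
  also have "(T powr r) powr ((r - 1) / r) = T powr (r - 1)"
    using assms by (simp add: powr_powr)
  finally have "t * T powr (r - 1) * r \<le> t powr r + (r - 1) * T powr r"
    using assms by (simp add: field_simps)
  moreover have "T * T powr (r - 1) = T powr r"
    using assms by (simp add: powr_mult_base)
  ultimately show ?thesis
    by (simp add: algebra_simps)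
qed

text \<open>Average the tangent inequality at the mean T: the weights sum to 1, so the linear terms
  cancel.\<close>

lemma powr_jensen:
  fixes w t :: "'a \<Rightarrow> real"
  assumes "\<And>i. i \<in> A \<Longrightarrow> w i \<ge> 0" "\<And>i. i \<in> A \<Longrightarrow> t i \<ge> 0" "(\<Sum>i\<in>A. w i) = 1" "r \<ge> 1"
  shows "(\<Sum>i\<in>A. w i * t i) powr r \<le> (\<Sum>i\<in>A. w i * t i powr r)"
proof -
  define T where "T = (\<Sum>i\<in>A. w i * t i)"
  have "T \<ge> 0" unfolding T_def using assms by (intro sum_nonneg) auto
  show ?thesis
  proof (cases "T = 0")
    case True
    then show ?thesis using assms by (auto simp flip: T_def intro!: sum_nonneg)
  next
    case False
    then have "T > 0" using \<open>T \<ge> 0\<close> by simp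
    have "(\<Sum>i\<in>A. w i * (T powr r + r * T powr (r - 1) * (t i - T))) \<le> (\<Sum>i\<in>A. w i * t i powr r)"
      using assms \<open>T > 0\<close> by (intro sum_mono mult_left_mono powr_tangent_le) auto
    also have "(\<Sum>i\<in>A. w i * (T powr r + r * T powr (r - 1) * (t i - T))) =
        T powr r * (\<Sum>i\<in>A. w i) + r * T powr (r - 1) * ((\<Sum>i\<in>A. w i * t i) - T * (\<Sum>i\<in>A. w i))"
      by (simp add: sum_distrib_left sum_distrib_right sum_subtractf sum.distrib algebra_simps)
    also have "\<dots> = T powr r" using assms by (simp flip: T_def)
    finally show ?thesis by (simp add: T_def)
  qed
qed

text \<open>Jensen with uniform weights, applied to the values \<open>a i\<close> scaled by the
  number of terms. Used on sums over states, it is the origin of the factor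
  \<open>CARD('s) powr \<rho>\<close>.\<close>

lemma sum_powr_le:
  fixes a :: "'a \<Rightarrow> real"
  assumes "finite A" "A \<noteq> {}" "\<And>i. i \<in> A \<Longrightarrow> a i \<ge> 0" "r \<ge> 1"
  shows "(\<Sum>i\<in>A. a i) powr r \<le> real (card A) powr (r - 1) * (\<Sum>i\<in>A. a i powr r)"
proof -
  let ?n = "real (card A)"
  have n: "?n > 0" using assms by (simp add: card_gt_0_iff)
  have "(\<Sum>i\<in>A. (1 / ?n) * (?n * a i)) powr r \<le> (\<Sum>i\<in>A. (1 / ?n) * (?n * a i) powr r)"
    using assms n by (intro powr_jensen) auto
  also have "\<dots> = (\<Sum>i\<in>A. ?n powr (r - 1) * a i powr r)"
    using assms n by (intro sum.cong) (auto simp: powr_mult powr_diff)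
  finally show ?thesis using n by (simp add: sum_distrib_left)
qed

text \<open>Divide by the total: each share lies in [0, 1], where a power with exponent at most 1
  can only increase it, and the shares add up to 1.\<close>

lemma powr_sum_le:
  fixes a :: "'a \<Rightarrow> real"
  assumes "finite A" "\<And>i. i \<in> A \<Longrightarrow> a i \<ge> 0" "0 < t" "t \<le> 1"
  shows "(\<Sum>i\<in>A. a i) powr t \<le> (\<Sum>i\<in>A. a i powr t)"
proof -
  define T where "T = (\<Sum>i\<in>A. a i)"
  have T0: "T \<ge> 0" unfolding T_def using assms by (intro sum_nonneg) auto
  show ?thesis
  proof (cases "T = 0")
    case True
    then show ?thesis by (auto simp flip: T_def intro!: sum_nonneg)
  next
    case False
    then have T: "T > 0" using T0 by simp
    have "a i / T \<le> (a i / T) powr t" if "i \<in> A" for i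
    proof -
      have "a i \<le> T" unfolding T_def using assms that by (intro member_le_sum) auto
      then have "(a i / T) powr 1 \<le> (a i / T) powr t"
        using assms that T by (intro powr_mono') auto
      then show ?thesis using assms that T by simp
    qed
    then have "(\<Sum>i\<in>A. a i / T) \<le> (\<Sum>i\<in>A. (a i / T) powr t)" by (rule sum_mono)
    also have "(\<Sum>i\<in>A. a i / T) = 1"
      using T by (simp add: T_def flip: sum_divide_distrib)
    also have "(\<Sum>i\<in>A. (a i / T) powr t) = (\<Sum>i\<in>A. a i powr t) / T powr t"
      using assms T by (simp add: powr_divide sum_divide_distrib)
    finally show ?thesis using T by (simp add: field_simps flip: T_def)
  qed
qed

text \<open>Minkowski's inequality, reduced to Jensen. With C x the sum of \<open>c x s\<close> over
  s, the weights proportional to \<open>Q x * C x powr (1 / r)\<close> turn the inner sum into an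
  average of r-th roots of the shares \<open>c x s / C x\<close>. Jensen removes the roots, and the
  shares of each x sum to at most 1.\<close>

lemma minkowski_sum:
  fixes Q :: "'a \<Rightarrow> real" and c :: "'a \<Rightarrow> 'b \<Rightarrow> real"
  assumes "finite A" "finite B" "r \<ge> 1"
    and Q: "\<And>x. x \<in> A \<Longrightarrow> Q x \<ge> 0" and c: "\<And>x s. x \<in> A \<Longrightarrow> s \<in> B \<Longrightarrow> c x s \<ge> 0"
  shows "(\<Sum>s\<in>B. (\<Sum>x\<in>A. Q x * c x s powr (1 / r)) powr r)
       \<le> (\<Sum>x\<in>A. Q x * (\<Sum>s\<in>B. c x s) powr (1 / r)) powr r"
proof -
  define C where "C x = (\<Sum>s\<in>B. c x s)" for x
  define T where "T = (\<Sum>x\<in>A. Q x * C x powr (1 / r))"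
  define w where "w x = Q x * C x powr (1 / r) / T" for x
  have C0: "C x \<ge> 0" if "x \<in> A" for x unfolding C_def using that c by (intro sum_nonneg) auto
  have Cc: "c x s = 0" if "C x = 0" "x \<in> A" "s \<in> B" for x s
    using that assms sum_nonneg_eq_0_iff[of B "c x"] by (auto simp: C_def)
  have T0: "T \<ge> 0" unfolding T_def using Q by (intro sum_nonneg) auto
  have r: "r > 0" using assms by simp
  show ?thesis
  proof (cases "T = 0")
    case True
    then have z: "Q x * C x powr (1 / r) = 0" if "x \<in> A" for x
      using that Q assms sum_nonneg_eq_0_iff[of A "\<lambda>x. Q x * C x powr (1 / r)"] by (auto simp: T_def)
    have "Q x * c x s powr (1 / r) = 0" if "x \<in> A" "s \<in> B" for x s
      using z[of x] Cc[of x s] that by auto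
    then have "(\<Sum>x\<in>A. Q x * c x s powr (1 / r)) = 0" if "s \<in> B" for s
      using that by (intro sum.neutral) auto
    then show ?thesis by simp
  next
    case False
    then have T: "T > 0" using T0 by simp
    have w0: "w x \<ge> 0" if "x \<in> A" for x using Q that T by (simp add: w_def)
    have w1: "(\<Sum>x\<in>A. w x) = 1"
      using T by (simp add: w_def T_def flip: sum_divide_distrib)
    have eq: "Q x * c x s powr (1 / r) = T * (w x * (c x s / C x) powr (1 / r))"
      if "x \<in> A" "s \<in> B" for x s
    proof (cases "C x = 0")
      case False
      then have "C x > 0" using C0 that by force
      then show ?thesis using T c that by (simp add: w_def powr_divide)
    qed (use Cc that in auto)
    have "(\<Sum>s\<in>B. (\<Sum>x\<in>A. Q x * c x s powr (1 / r)) powr r)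
        = (\<Sum>s\<in>B. T powr r * (\<Sum>x\<in>A. w x * (c x s / C x) powr (1 / r)) powr r)"
      using w0 T0 by (intro sum.cong) (simp_all add: eq powr_mult sum_nonneg flip: sum_distrib_left)
    also have "\<dots> \<le> (\<Sum>s\<in>B. T powr r * (\<Sum>x\<in>A. w x * ((c x s / C x) powr (1 / r)) powr r))"
      using w0 w1 assms by (intro sum_mono mult_left_mono powr_jensen) auto
    also have "\<dots> = (\<Sum>s\<in>B. T powr r * (\<Sum>x\<in>A. w x * (c x s / C x)))"
      using r C0 c by (intro sum.cong arg_cong2[where f="(*)"]) (auto simp: powr_powr)
    also have "\<dots> = T powr r * (\<Sum>x\<in>A. w x * (\<Sum>s\<in>B. c x s / C x))"
      unfolding sum_distrib_left by (rule sum.swap)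
    \<comment> \<open>Only an inequality: for \<open>C x = 0\<close> division by zero makes the
      shares sum to 0 instead of 1.\<close>
    also have "\<dots> \<le> T powr r * (\<Sum>x\<in>A. w x * 1)"
    proof (intro mult_left_mono sum_mono)
      fix x assume "x \<in> A"
      have "(\<Sum>s\<in>B. c x s / C x) = C x / C x" unfolding C_def by (rule sum_divide_distrib[symmetric])
      then show "(\<Sum>s\<in>B. c x s / C x) \<le> 1" by simp
    qed (use w0 in auto)
    also have "\<dots> = T powr r" using w1 by simp
    finally show ?thesis unfolding T_def C_def .
  qed
qed

text \<open>The log sum inequality, from \<open>ln u \<le> u - 1\<close> at the ratio of
  \<open>b i / p i\<close> to the ratio of the totals. A term with \<open>p i = 0\<close> vanishes,
  so positivity of \<open>b i\<close> matters only where \<open>p i\<close> is positive.\<close>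

lemma log_sum_le:
  fixes p b :: "'a \<Rightarrow> real"
  assumes A: "finite A" and p: "\<And>i. i \<in> A \<Longrightarrow> p i \<ge> 0" and b: "\<And>i. i \<in> A \<Longrightarrow> b i \<ge> 0"
    and pb: "\<And>i. i \<in> A \<Longrightarrow> p i > 0 \<Longrightarrow> b i > 0"
  shows "(\<Sum>i\<in>A. p i * ln (b i / p i)) \<le> (\<Sum>i\<in>A. p i) * ln ((\<Sum>i\<in>A. b i) / (\<Sum>i\<in>A. p i))"
proof -
  define s where "s = (\<Sum>i\<in>A. p i)"
  define B where "B = (\<Sum>i\<in>A. b i)"
  show ?thesis
  proof (cases "s = 0")
    case True
    then have "p i = 0" if "i \<in> A" for i
      using that A p sum_nonneg_eq_0_iff[of A p] by (auto simp: s_def)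
    then show ?thesis by simp
  next
    case False
    have "s \<ge> 0" unfolding s_def using p by (intro sum_nonneg) auto
    then have s: "s > 0" using False by simp
    then obtain j where j: "j \<in> A" "p j > 0" using p unfolding s_def
      by (metis less_irrefl linorder_not_le sum_nonpos)
    have "b j \<le> B" unfolding B_def using A b j by (intro member_le_sum) auto
    then have B: "B > 0" using pb[OF j] by simp
    \<comment> \<open>The bracketed correction sums to B - B's share s times 1, that is to s - s = 0
      over A.\<close>
    have "p i * ln (b i / p i) \<le> p i * ln (B / s) + (b i * s / B - p i)" if "i \<in> A" for i
    proof (cases "p i = 0")
      case True
      then show ?thesis using b[OF that] s B by simp
    next
      case False
      then have pi: "p i > 0" "b i > 0" using p pb that by force+
      have "ln (b i / p i) - ln (B / s) = ln ((b i / p i) / (B / s))"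
        using pi s B by (subst ln_div) auto
      also have "\<dots> \<le> (b i / p i) / (B / s) - 1"
        using pi s B by (intro ln_le_minus_one) auto
      finally have "p i * (ln (b i / p i) - ln (B / s)) \<le> p i * ((b i / p i) / (B / s) - 1)"
        using pi by (intro mult_left_mono) auto
      also have "\<dots> = b i * s / B - p i" using pi by (simp add: field_simps)
      finally show ?thesis by (simp add: algebra_simps)
    qed
    then have "(\<Sum>i\<in>A. p i * ln (b i / p i)) \<le> (\<Sum>i\<in>A. p i * ln (B / s) + (b i * s / B - p i))"
      by (rule sum_mono)
    also have "\<dots> = s * ln (B / s) + (B * s / B - s)"
      by (simp add: sum.distrib sum_subtractf s_def B_def flip: sum_distrib_right sum_divide_distrib)
    finally show ?thesis using B by (simp add: s_def B_def)
  qed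
qed

text \<open>Fekete's lemma: cut n into copies of a nearly optimal block length k and one remainder;
  the error is bounded independently of n and disappears after division by n.\<close>

lemma superadditive_tendsto_SUP:
  fixes a :: "nat \<Rightarrow> real"
  assumes super: "\<And>m n. m \<ge> 1 \<Longrightarrow> n \<ge> 1 \<Longrightarrow> a m + a n \<le> a (m + n)"
    and bdd: "bdd_above ((\<lambda>n. a n / real n) ` {1..})"
  shows "(\<lambda>n. a n / real n) \<longlonglongrightarrow> (SUP n\<in>{1..}. a n / real n)"
proof (rule LIMSEQ_I)
  define L where "L = (SUP n\<in>{1..}. a n / real n)"
  have up: "a n / real n \<le> L" if "n \<ge> 1" for n
    unfolding L_def using bdd that by (intro cSUP_upper) auto
  fix e :: real assume e: "e > 0"
  have "L - e / 2 < L" using e by simp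
  then obtain k where k: "k \<ge> 1" "L - e / 2 < a k / real k"
    unfolding L_def using bdd by (subst (asm) less_cSUP_iff) auto
  define C where "C = Min (a ` {1..k})"
  have step: "real j * a k + a r \<le> a (j * k + r)" if "r \<ge> 1" for j r
  proof (induction j)
    case (Suc j)
    have "a k + a (j * k + r) \<le> a (k + (j * k + r))" using k that by (intro super) auto
    then show ?case using Suc by (simp add: algebra_simps)
  qed simp
  have low: "a k / real k - (\<bar>a k\<bar> + \<bar>C\<bar>) / real n \<le> a n / real n" if n: "n \<ge> 1" for n
  proof -
    \<comment> \<open>Dividing n - 1 rather than n puts the remainder r into 1..k, because
      superadditivity is assumed only for positive indices and says nothing about
      \<open>a 0\<close>.\<close>
    define j where "j = (n - 1) div k"
    define r where "r = (n - 1) mod k + 1"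
    have r: "r \<ge> 1" "r \<le> k" using k by (auto simp: r_def Suc_leI)
    have "(n - 1) = j * k + (n - 1) mod k" by (simp add: j_def)
    then have njr: "n = j * k + r" using n by (simp add: r_def)
    have "C \<le> a r" unfolding C_def using r by (intro Min_le) auto
    then have "real j * a k - \<bar>C\<bar> \<le> a n" using step[OF r(1), of j] njr by simp
    moreover have "real j * a k \<ge> real n * (a k / real k) - \<bar>a k\<bar>"
    proof -
      have "real n * (a k / real k) - real j * a k = a k * (real r / real k)"
        using k by (simp add: njr field_simps)
      also have "\<dots> \<le> \<bar>a k\<bar> * 1" using r k by (intro mult_mono) auto
      finally show ?thesis by simp
    qed
    ultimately have "real n * (a k / real k) - (\<bar>a k\<bar> + \<bar>C\<bar>) \<le> a n" by simp
    then have "(real n * (a k / real k) - (\<bar>a k\<bar> + \<bar>C\<bar>)) / real n \<le> a n / real n"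
      by (rule divide_right_mono) simp
    then show ?thesis using n by (simp add: diff_divide_distrib)
  qed
  obtain n0 where n0: "real n0 > (\<bar>a k\<bar> + \<bar>C\<bar>) / (e / 2)" using reals_Archimedean2 by blast
  have "norm (a n / real n - L) < e" if n: "n \<ge> max 1 n0" for n
  proof -
    have "real n > (\<bar>a k\<bar> + \<bar>C\<bar>) / (e / 2)" using n0 n by linarith
    then have "(\<bar>a k\<bar> + \<bar>C\<bar>) / real n < e / 2" using e n by (simp add: field_simps)
    moreover have "n \<ge> 1" using n by simp
    ultimately have "\<bar>a n / real n - L\<bar> < e" using low[of n] up[of n] k e by linarith
    then show ?thesis by simp
  qed
  then show "\<exists>n0. \<forall>n\<ge>n0. norm (a n / real n - (SUP n\<in>{1..}. a n / real n)) < e"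
    unfolding L_def by blast
qed

section \<open>Concatenation of blocks\<close>

lemma finite_length_eq [simp, intro]: "finite {xs :: 'a::finite list. length xs = n}"
  using finite_lists_length_eq[of "UNIV :: 'a set" n] by simp

lemma card_length_eq: "card {xs :: 'a::finite list. length xs = n} = CARD('a) ^ n"
  using card_lists_length_eq[of "UNIV :: 'a set" n] by simp

lemma length_eq_nonempty: "{xs :: 'a list. length xs = n} \<noteq> {}"
  using Ex_list_of_length[of n] by auto

lemma sum_length_add:
  fixes f :: "'a::finite list \<Rightarrow> 'b::comm_monoid_add"
  shows "(\<Sum>w | length w = n + l. f w) = (\<Sum>u | length u = n. \<Sum>v | length v = l. f (u @ v))"
proof -
  have "bij_betw (\<lambda>(u, v). u @ v) ({u :: 'a list. length u = n} \<times> {v. length v = l}) {w. length w = n + l}"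
    by (rule bij_betw_byWitness[where f' = "\<lambda>w. (take n w, drop n w)"]) auto
  from sum.reindex_bij_betw[OF this, of f]
  show ?thesis by (simp add: sum.cartesian_product case_prod_beta')
qed

text \<open>The probability of the outputs together with the state reached at the end of the block.
  Writing \<open>last (s0 # ss)\<close> also covers the empty block, which ends in s0.\<close>

definition end_state_prob ::
    "('x, 'y, 's::finite) kernel \<Rightarrow> 's \<Rightarrow> 'x list \<Rightarrow> 'y list \<Rightarrow> 's \<Rightarrow> real" where
  "end_state_prob W s0 xs ys s =
     (\<Sum>ss | length ss = length xs \<and> last (s0 # ss) = s. path_prob W s0 xs ys ss)"

lemma path_prob_nonneg: "path_prob W s0 xs ys ss \<ge> 0"
  unfolding path_prob_def by (intro prod_nonneg) auto

lemma channel_prob_nonneg: "channel_prob W s0 xs ys \<ge> 0"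
  unfolding channel_prob_def by (intro sum_nonneg) (auto simp: path_prob_nonneg)

lemma end_state_prob_nonneg: "end_state_prob W s0 xs ys s \<ge> 0"
  unfolding end_state_prob_def by (intro sum_nonneg) (auto simp: path_prob_nonneg)

lemma causal_prob_nonneg: "causal_prob q xs zs \<ge> 0"
  unfolding causal_prob_def by (intro prod_nonneg) auto

lemma sum_end_state_prob: "(\<Sum>s\<in>UNIV. end_state_prob W s0 xs ys s) = channel_prob W s0 xs ys"
proof -
  have "(\<Sum>s\<in>UNIV. end_state_prob W s0 xs ys s) =
      (\<Sum>s\<in>UNIV. \<Sum>ss | ss \<in> {ss. length ss = length xs} \<and> last (s0 # ss) = s. path_prob W s0 xs ys ss)"
    by (simp add: end_state_prob_def)
  also have "\<dots> = channel_prob W s0 xs ys"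
    unfolding channel_prob_def by (rule sum.group) auto
  finally show ?thesis .
qed

lemma path_prob_append:
  assumes "length y1 = length x1" "length s1 = length x1" "length s2 = length x2"
  shows "path_prob W s0 (x1 @ x2) (y1 @ y2) (s1 @ s2) =
    path_prob W s0 x1 y1 s1 * path_prob W (last (s0 # s1)) x2 y2 s2"
  using assms
proof (induction x1 arbitrary: s0 y1 s1)
  case Nil
  then show ?case by (simp add: path_prob_def)
next
  case (Cons x x1)
  obtain y y1' where y: "y1 = y # y1'" "length y1' = length x1" using Cons.prems by (cases y1) auto
  obtain s s1' where s: "s1 = s # s1'" "length s1' = length x1" using Cons.prems by (cases s1) auto
  have step: "path_prob W s0 (x # xs) (y # ys) (s # ss) = pmf (W x s0) (y, s) * path_prob W s xs ys ss" for xs ys ss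
    unfolding path_prob_def length_Cons prod.lessThan_Suc_shift by simp
  show ?case
    using Cons.IH[OF y(2) s(2) Cons.prems(3), of s] by (simp add: y s step)
qed

lemma channel_prob_append:
  fixes W :: "('x, 'y, 's::finite) kernel"
  assumes "length y1 = length x1"
  shows "channel_prob W s0 (x1 @ x2) (y1 @ y2) =
    (\<Sum>s\<in>UNIV. end_state_prob W s0 x1 y1 s * channel_prob W s x2 y2)"
proof -
  have "channel_prob W s0 (x1 @ x2) (y1 @ y2) =
      (\<Sum>s1 | length s1 = length x1. path_prob W s0 x1 y1 s1 * channel_prob W (last (s0 # s1)) x2 y2)"
    using assms
    by (simp add: channel_prob_def sum_length_add path_prob_append sum_distrib_left)
  also have "\<dots> = (\<Sum>s\<in>UNIV. \<Sum>s1 | s1 \<in> {s1. length s1 = length x1} \<and> last (s0 # s1) = s.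
      path_prob W s0 x1 y1 s1 * channel_prob W (last (s0 # s1)) x2 y2)"
    by (rule sum.group[symmetric]) auto
  also have "\<dots> = (\<Sum>s\<in>UNIV. end_state_prob W s0 x1 y1 s * channel_prob W s x2 y2)"
    unfolding end_state_prob_def sum_distrib_right by (intro sum.cong) auto
  finally show ?thesis .
qed

text \<open>The second law restarts from empty histories and ignores all that happened in the first
  block. This makes the input probability factor; the blocks then interact only through the channel
  state at the boundary.\<close>

definition concat_input ::
    "nat \<Rightarrow> ('x, 'z) causal_input \<Rightarrow> ('x, 'z) causal_input \<Rightarrow> ('x, 'z) causal_input" where
  "concat_input n q1 q2 xs zs = (if length xs < n then q1 xs zs else q2 (drop n xs) (drop n zs))"

lemma prod_lessThan_add:
  fixes f :: "nat \<Rightarrow> 'a::comm_monoid_mult"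
  shows "(\<Prod>i<n + l. f i) = (\<Prod>i<n. f i) * (\<Prod>i<l. f (n + i))"
  by (induction l) (simp_all add: mult.assoc)

lemma causal_prob_concat_input:
  assumes "length x1 = n" "length z1 = n"
  shows "causal_prob (concat_input n q1 q2) (x1 @ x2) (z1 @ z2) = causal_prob q1 x1 z1 * causal_prob q2 x2 z2"
proof -
  let ?f = "\<lambda>i. pmf (concat_input n q1 q2 (take i (x1 @ x2)) (take i (z1 @ z2))) ((x1 @ x2) ! i)"
  have "causal_prob (concat_input n q1 q2) (x1 @ x2) (z1 @ z2) = (\<Prod>i<n + length x2. ?f i)"
    using assms by (simp add: causal_prob_def)
  also have "\<dots> = (\<Prod>i<n. ?f i) * (\<Prod>i<length x2. ?f (n + i))"
    by (rule prod_lessThan_add)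
  also have "\<dots> = causal_prob q1 x1 z1 * causal_prob q2 x2 z2"
    unfolding causal_prob_def using assms
    by (intro arg_cong2[where f = "(*)"] prod.cong) (auto simp: concat_input_def nth_append)
  finally show ?thesis .
qed

text \<open>For positive N this is 2 to the power \<open>- N * E_o\<close>. The multiplicative form
  is convenient for sums over boundary states and for differentiation in \<rho>.\<close>

definition gallager_sum :: "('x::finite, 'y::finite, 's::finite) kernel \<Rightarrow> ('y \<Rightarrow> 'z) \<Rightarrow> nat
    \<Rightarrow> real \<Rightarrow> ('x, 'z) causal_input \<Rightarrow> 's \<Rightarrow> real" where
  "gallager_sum W z N \<rho> q s0 =
     (\<Sum>ys | length ys = N.
        (\<Sum>xs | length xs = N.
           causal_prob q xs (map z ys) * channel_prob W s0 xs ys powr (1 / (1 + \<rho>)))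
        powr (1 + \<rho>))"

lemma E_o_gallager_sum: "E_o W z N \<rho> q s0 = - (1 / real N) * log 2 (gallager_sum W z N \<rho> q s0)"
  by (simp add: E_o_def gallager_sum_def)

lemma gallager_sum_nonneg: "gallager_sum W z N \<rho> q s0 \<ge> 0"
  unfolding gallager_sum_def by (intro sum_nonneg) simp

text \<open>Condition on the boundary state s. The exponent 1/r with r = 1 + \<rho> is subadditive,
  so the sum over s moves outside, where the inputs of the two blocks separate into
  \<open>A y1 s\<close> and \<open>D y2 s\<close>. Summing r-th powers over y2 gives the second
  block's sum started in s, bounded by B uniformly in s; Minkowski then recombines the states of the
  first block.\<close>

lemma gallager_sum_concat_input:
  fixes W :: "('x::finite, 'y::finite, 's::finite) kernel"
  assumes \<rho>: "\<rho> \<ge> 0" and B: "\<And>s. gallager_sum W z l \<rho> q2 s \<le> B"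
  shows "gallager_sum W z (n + l) \<rho> (concat_input n q1 q2) s0
    \<le> real CARD('s) powr \<rho> * gallager_sum W z n \<rho> q1 s0 * B"
proof -
  define r where "r = 1 + \<rho>"
  have r: "r \<ge> 1" using \<rho> by (simp add: r_def)
  define A where "A y1 s = (\<Sum>x1 | length x1 = n. causal_prob q1 x1 (map z y1) * end_state_prob W s0 x1 y1 s powr (1 / r))" for y1 s
  define D where "D y2 s = (\<Sum>x2 | length x2 = l. causal_prob q2 x2 (map z y2) * channel_prob W s x2 y2 powr (1 / r))" for y2 s
  have A0: "A y s \<ge> 0" for y s unfolding A_def by (intro sum_nonneg) (simp add: causal_prob_nonneg)
  have D0: "D y s \<ge> 0" for y s unfolding D_def by (intro sum_nonneg) (simp add: causal_prob_nonneg)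
  have split: "channel_prob W s0 (x1 @ x2) (y1 @ y2) powr (1 / r)
      \<le> (\<Sum>s\<in>UNIV. end_state_prob W s0 x1 y1 s powr (1 / r) * channel_prob W s x2 y2 powr (1 / r))"
    if "length x1 = n" "length y1 = n" for x1 x2 y1 y2
    using powr_sum_le[of UNIV "\<lambda>s. end_state_prob W s0 x1 y1 s * channel_prob W s x2 y2" "1 / r"] that r
    by (simp add: channel_prob_append powr_mult end_state_prob_nonneg channel_prob_nonneg)
  have inner: "(\<Sum>xs | length xs = n + l. causal_prob (concat_input n q1 q2) xs (map z (y1 @ y2))
        * channel_prob W s0 xs (y1 @ y2) powr (1 / r)) powr r
      \<le> real CARD('s) powr \<rho> * (\<Sum>s\<in>UNIV. A y1 s powr r * D y2 s powr r)"
    if "length y1 = n" "length y2 = l" for y1 y2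
  proof -
    have "(\<Sum>xs | length xs = n + l. causal_prob (concat_input n q1 q2) xs (map z (y1 @ y2))
        * channel_prob W s0 xs (y1 @ y2) powr (1 / r)) =
      (\<Sum>x1 | length x1 = n. \<Sum>x2 | length x2 = l. causal_prob q1 x1 (map z y1) * causal_prob q2 x2 (map z y2)
        * channel_prob W s0 (x1 @ x2) (y1 @ y2) powr (1 / r))"
      unfolding sum_length_add using that by (intro sum.cong) (auto simp: causal_prob_concat_input)
    also have "\<dots> \<le> (\<Sum>x1 | length x1 = n. \<Sum>x2 | length x2 = l. causal_prob q1 x1 (map z y1) * causal_prob q2 x2 (map z y2)
        * (\<Sum>s\<in>UNIV. end_state_prob W s0 x1 y1 s powr (1 / r) * channel_prob W s x2 y2 powr (1 / r)))"
      using that by (intro sum_mono mult_left_mono split) (auto simp: causal_prob_nonneg)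
    also have "\<dots> = (\<Sum>x1 | length x1 = n. \<Sum>x2 | length x2 = l. \<Sum>s\<in>UNIV.
        (causal_prob q1 x1 (map z y1) * end_state_prob W s0 x1 y1 s powr (1 / r)) *
        (causal_prob q2 x2 (map z y2) * channel_prob W s x2 y2 powr (1 / r)))"
      unfolding sum_distrib_left by (intro sum.cong) (auto simp: mult_ac)
    also have "\<dots> = (\<Sum>x1 | length x1 = n. \<Sum>s\<in>UNIV. \<Sum>x2 | length x2 = l.
        (causal_prob q1 x1 (map z y1) * end_state_prob W s0 x1 y1 s powr (1 / r)) *
        (causal_prob q2 x2 (map z y2) * channel_prob W s x2 y2 powr (1 / r)))"
      by (intro sum.cong refl sum.swap)
    also have "\<dots> = (\<Sum>s\<in>UNIV. \<Sum>x1 | length x1 = n. \<Sum>x2 | length x2 = l.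
        (causal_prob q1 x1 (map z y1) * end_state_prob W s0 x1 y1 s powr (1 / r)) *
        (causal_prob q2 x2 (map z y2) * channel_prob W s x2 y2 powr (1 / r)))"
      by (rule sum.swap)
    also have "\<dots> = (\<Sum>s\<in>UNIV. A y1 s * D y2 s)"
      unfolding A_def D_def sum_product ..
    finally have "(\<Sum>xs | length xs = n + l. causal_prob (concat_input n q1 q2) xs (map z (y1 @ y2))
        * channel_prob W s0 xs (y1 @ y2) powr (1 / r)) powr r \<le> (\<Sum>s\<in>UNIV. A y1 s * D y2 s) powr r"
      using r by (intro powr_mono2) (auto intro!: sum_nonneg simp: causal_prob_nonneg)
    \<comment> \<open>The only step in which the number of states is paid for.\<close>
    also have "\<dots> \<le> real CARD('s) powr (r - 1) * (\<Sum>s\<in>UNIV. (A y1 s * D y2 s) powr r)"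
      using r A0 D0 by (intro sum_powr_le) auto
    finally show ?thesis using A0 D0 by (simp add: powr_mult r_def)
  qed
  have "gallager_sum W z (n + l) \<rho> (concat_input n q1 q2) s0 =
      (\<Sum>y1 | length y1 = n. \<Sum>y2 | length y2 = l.
        (\<Sum>xs | length xs = n + l. causal_prob (concat_input n q1 q2) xs (map z (y1 @ y2))
        * channel_prob W s0 xs (y1 @ y2) powr (1 / r)) powr r)"
    unfolding gallager_sum_def sum_length_add[of _ n l, where 'a = 'y] r_def ..
  also have "\<dots> \<le> (\<Sum>y1 | length y1 = n. \<Sum>y2 | length y2 = l.
       real CARD('s) powr \<rho> * (\<Sum>s\<in>UNIV. A y1 s powr r * D y2 s powr r))"
    by (intro sum_mono inner) auto
  also have "\<dots> = real CARD('s) powr \<rho> * (\<Sum>y1 | length y1 = n. \<Sum>y2 | length y2 = l. \<Sum>s\<in>UNIV. A y1 s powr r * D y2 s powr r)"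
    by (simp add: sum_distrib_left)
  also have "\<dots> = real CARD('s) powr \<rho> * (\<Sum>y1 | length y1 = n. \<Sum>s\<in>UNIV. A y1 s powr r * gallager_sum W z l \<rho> q2 s)"
    unfolding gallager_sum_def D_def sum_distrib_left r_def
    by (intro arg_cong2[where f = "(*)"] sum.cong refl sum.swap)
  also have "\<dots> \<le> real CARD('s) powr \<rho> * (\<Sum>y1 | length y1 = n. \<Sum>s\<in>UNIV. A y1 s powr r * B)"
    by (intro mult_left_mono sum_mono B) auto
  also have "\<dots> = real CARD('s) powr \<rho> * ((\<Sum>y1 | length y1 = n. \<Sum>s\<in>UNIV. A y1 s powr r) * B)"
    by (simp add: sum_distrib_right)
  also have "\<dots> \<le> real CARD('s) powr \<rho> * (gallager_sum W z n \<rho> q1 s0 * B)"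
  \<comment> \<open>Minkowski merges the end states back into \<open>channel_prob\<close>. Bounding
    each \<open>end_state_prob\<close> by \<open>channel_prob\<close> separately would lose a
    further factor \<open>CARD('s)\<close>, which \<open>F_N\<close> does not pay for.\<close>
  proof -
    have "(\<Sum>s\<in>UNIV. A y1 s powr r) \<le> (\<Sum>x1 | length x1 = n. causal_prob q1 x1 (map z y1) * channel_prob W s0 x1 y1 powr (1 / r)) powr r" for y1
      unfolding A_def sum_end_state_prob[symmetric]
      using r by (intro minkowski_sum) (auto simp: causal_prob_nonneg end_state_prob_nonneg)
    then have "(\<Sum>y1 | length y1 = n. \<Sum>s\<in>UNIV. A y1 s powr r) \<le> gallager_sum W z n \<rho> q1 s0"
      unfolding gallager_sum_def r_def by (intro sum_mono)
    moreover have "B \<ge> 0"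
      using B gallager_sum_nonneg by (rule order_trans[rotated])
    ultimately show ?thesis by (intro mult_left_mono mult_right_mono) auto
  qed
  finally show ?thesis by (simp add: mult.assoc)
qed

section \<open>Directed information\<close>

lemma set_pmf_joint_law: "(xs, ys) \<in> set_pmf (joint_law W z q s0 N) \<Longrightarrow> length xs = N \<and> length ys = N"
  by (auto simp: joint_law_def dest: fsc_run_lengths)

lemma expectation_joint_law:
  fixes W :: "('x::finite, 'y::finite, 's::finite) kernel" and f :: "'x list \<times> 'y list \<Rightarrow> real"
  shows "measure_pmf.expectation (joint_law W z q s0 N) f =
    (\<Sum>ys | length ys = N. \<Sum>xs | length xs = N.
       causal_prob q xs (map z ys) * channel_prob W s0 xs ys * f (xs, ys))"
proof -
  have "measure_pmf.expectation (joint_law W z q s0 N) f =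
      (\<Sum>w\<in>{xs. length xs = N} \<times> {ys. length ys = N}. f w * pmf (joint_law W z q s0 N) w)"
    by (rule integral_measure_pmf_real) (auto dest: set_pmf_joint_law)
  also have "\<dots> = (\<Sum>xs | length xs = N. \<Sum>ys | length ys = N. f (xs, ys) * pmf (joint_law W z q s0 N) (xs, ys))"
    by (subst sum.cartesian_product) (simp add: case_prod_beta')
  also have "\<dots> = (\<Sum>ys | length ys = N. \<Sum>xs | length xs = N. f (xs, ys) * pmf (joint_law W z q s0 N) (xs, ys))"
    by (rule sum.swap)
  finally show ?thesis by (simp add: pmf_joint_law mult_ac)
qed

lemma sum_joint_prob:
  fixes W :: "('x::finite, 'y::finite, 's::finite) kernel"
  shows "(\<Sum>ys | length ys = N. \<Sum>xs | length xs = N. causal_prob q xs (map z ys) * channel_prob W s0 xs ys) = 1"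
  using expectation_joint_law[of W z q s0 N "\<lambda>_. 1"] by simp

text \<open>Use the deterministic input law that plays xs letter by letter: its causal probability
  of xs is 1, so the channel probability becomes a value of a mass function.\<close>

lemma channel_prob_le_1:
  fixes W :: "('x::finite, 'y::finite, 's::finite) kernel"
  assumes "length ys = length xs"
  shows "channel_prob W s0 xs ys \<le> 1"
proof -
  define q :: "('x, 'y) causal_input" where "q = (\<lambda>us _. return_pmf (xs ! length us))"
  have "causal_prob q xs (map (\<lambda>y. y) ys) = 1"
    by (simp add: causal_prob_def q_def)
  then have "channel_prob W s0 xs ys = pmf (joint_law W (\<lambda>y. y) q s0 (length xs)) (xs, ys)"
    using assms by (simp add: pmf_joint_law)
  then show ?thesis by (simp add: pmf_le_1)
qed

lemma joint_law_take:
  assumes "n \<le> N"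
  shows "map_pmf (\<lambda>(xs, ys). (take n xs, take n ys)) (joint_law W z q s0 N) = joint_law W z q s0 n"
proof -
  let ?t = "\<lambda>(xs, ys, ss). (take n xs, take n ys)"
  have "map_pmf ?t (fsc_run W z q s0 N) = map_pmf ?t (fsc_run W z q s0 n)"
    using assms
  proof (induction N rule: dec_induct)
    case (step N)
    have "map_pmf ?t (fsc_run W z q s0 (Suc N)) =
        bind_pmf (fsc_run W z q s0 N) (\<lambda>w. return_pmf (?t w))"
      unfolding fsc_run.simps map_bind_pmf
    proof (rule bind_pmf_cong[OF refl])
      fix w assume "w \<in> set_pmf (fsc_run W z q s0 N)"
      then obtain xs ys ss where w: "w = (xs, ys, ss)" "length xs = N" "length ys = N"
        by (metis fsc_run_lengths prod_cases3)
      then show "map_pmf ?t (case w of (xs, ys, ss) \<Rightarrow> q xs (map z ys) \<bind> (\<lambda>x. W x (last (s0 # ss)) \<bind>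
          (\<lambda>(y, s). return_pmf (xs @ [x], ys @ [y], ss @ [s])))) = return_pmf (?t w)"
        using step.hyps by (simp add: map_bind_pmf case_prod_beta')
    qed
    also have "\<dots> = map_pmf ?t (fsc_run W z q s0 N)" by (simp add: map_pmf_def)
    finally show ?case using step.IH by simp
  qed simp
  moreover have "map_pmf ?t (fsc_run W z q s0 n) = map_pmf (\<lambda>(xs, ys, ss). (xs, ys)) (fsc_run W z q s0 n)"
    by (rule map_pmf_cong) (auto dest: fsc_run_lengths)
  ultimately show ?thesis
    by (simp add: joint_law_def pmf.map_comp o_def case_prod_beta')
qed

text \<open>An input whose output is summed out has no influence: conditionally on the current state
  the kernel has total mass 1. This is the causality of the channel.\<close>

lemma sum_channel_prob_snoc:
  fixes W :: "('x, 'y::finite, 's::finite) kernel"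
  assumes "length ys = length xs"
  shows "(\<Sum>y\<in>UNIV. channel_prob W s0 (xs @ [x]) (ys @ [y])) = channel_prob W s0 xs ys"
proof -
  have one: "channel_prob W s [x] [y] = (\<Sum>t\<in>UNIV. pmf (W x s) (y, t))" for s y
  proof -
    have "bij_betw (\<lambda>t::'s. [t]) UNIV {ss. length ss = 1}"
      by (rule bij_betw_byWitness[where f' = hd]) (auto simp: length_Suc_conv)
    from sum.reindex_bij_betw[OF this, of "path_prob W s [x] [y]"]
    show ?thesis by (simp add: channel_prob_def path_prob_def)
  qed
  have "(\<Sum>y\<in>UNIV. channel_prob W s [x] [y]) = 1" for s
    using sum_pmf_eq_1[OF finite subset_UNIV, of "W x s"]
    by (simp add: one sum.cartesian_product flip: UNIV_Times_UNIV)
  moreover have "(\<Sum>y\<in>UNIV. channel_prob W s0 (xs @ [x]) (ys @ [y])) =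
      (\<Sum>s\<in>UNIV. end_state_prob W s0 xs ys s * (\<Sum>y\<in>UNIV. channel_prob W s [x] [y]))"
    using assms by (simp add: channel_prob_append sum_distrib_left) (rule sum.swap)
  ultimately show ?thesis by (simp add: sum_end_state_prob)
qed

text \<open>In the i-th term of the directed information the inputs are one step ahead of the
  conditioning outputs. The law of that pair comes from the law at time i + 1 by summing out the
  last output.\<close>

lemma pmf_joint_law_input_ahead:
  fixes W :: "('x, 'y::finite, 's::finite) kernel"
  assumes i: "i < N" and len: "length xs = i" "length ys = i"
  shows "pmf (map_pmf (\<lambda>(xs, ys). (take (Suc i) xs, take i ys)) (joint_law W z q s0 N)) (xs @ [x], ys) =
    causal_prob q xs (map z ys) * pmf (q xs (map z ys)) x * channel_prob W s0 xs ys"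
proof -
  let ?J = "joint_law W z q s0 (Suc i)"
  let ?A = "(\<lambda>y. (xs @ [x], ys @ [y])) ` UNIV"
  have "map_pmf (\<lambda>(xs, ys). (take (Suc i) xs, take i ys)) (joint_law W z q s0 N) =
      map_pmf (\<lambda>(xs, ys). (xs, take i ys)) ?J"
    unfolding joint_law_take[OF Suc_leI[OF i], symmetric]
    by (simp add: pmf.map_comp o_def case_prod_beta' min_def)
  also have "pmf \<dots> (xs @ [x], ys) = measure_pmf.prob ?J ((\<lambda>(xs, ys). (xs, take i ys)) -` {(xs @ [x], ys)})"
    by (simp add: pmf_map)
  also have "\<dots> = measure_pmf.prob ?J ?A"
  proof (intro measure_pmf.finite_measure_eq_AE)
    show "AE w in measure_pmf ?J. (w \<in> (\<lambda>(xs, ys). (xs, take i ys)) -` {(xs @ [x], ys)}) = (w \<in> ?A)"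
    proof (rule AE_pmfI)
      fix w assume w: "w \<in> set_pmf ?J"
      obtain a b where ab: "w = (a, b)" by (cases w)
      have b: "b = take i b @ [b ! i]"
        using set_pmf_joint_law[of a b] w ab by (metis lessI take_Suc_conv_app_nth take_all order_refl)
      show "(w \<in> (\<lambda>(xs, ys). (xs, take i ys)) -` {(xs @ [x], ys)}) = (w \<in> ?A)"
        using b len by (auto simp: ab)
    qed
  qed auto
  also have "\<dots> = (\<Sum>w\<in>?A. pmf ?J w)"
    by (simp add: measure_measure_pmf_finite)
  also have "\<dots> = (\<Sum>y\<in>UNIV. pmf ?J (xs @ [x], ys @ [y]))"
    by (subst sum.reindex) (auto simp: inj_on_def)
  also have "\<dots> = causal_prob q xs (map z ys) * pmf (q xs (map z ys)) x
      * (\<Sum>y\<in>UNIV. channel_prob W s0 (xs @ [x]) (ys @ [y]))"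
    using len by (simp add: pmf_joint_law causal_prob_snoc sum_distrib_left)
  finally show ?thesis using len by (simp add: sum_channel_prob_snoc)
qed

text \<open>A point mass of an image law depends only on the fibre through w. It lets a pair of a
  prefix and the next letter be replaced by the longer prefix.\<close>

lemma pmf_map_eq_if_same_fibre:
  assumes "\<And>v. v \<in> set_pmf p \<Longrightarrow> f v = f w \<longleftrightarrow> g v = g w"
  shows "pmf (map_pmf f p) (f w) = pmf (map_pmf g p) (g w)"
  unfolding pmf_map
  by (intro measure_pmf.finite_measure_eq_AE AE_pmfI) (auto simp: assms)

lemma cond_mutual_info_expectation:
  fixes X :: "'a \<Rightarrow> 'b" and Y :: "'a \<Rightarrow> 'c" and U :: "'a \<Rightarrow> 'd"
  assumes fin: "finite (range X)" "finite (range Y)" "finite (range U)"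
  shows "cond_mutual_info p X Y U = measure_pmf.expectation p (\<lambda>w. log 2
     (pmf (map_pmf (\<lambda>w. (X w, Y w, U w)) p) (X w, Y w, U w) /
       (pmf (map_pmf (\<lambda>w. (X w, U w)) p) (X w, U w) *
         (pmf (map_pmf (\<lambda>w. (Y w, U w)) p) (Y w, U w) / pmf (map_pmf U p) (U w)))))"
proof -
  interpret information_space "measure_pmf p" 2
    by unfold_locales simp
  have sd: "simple_distributed (measure_pmf p) T (pmf (map_pmf T p))" if "finite (range T)" for T :: "'a \<Rightarrow> 't"
    using that by (intro measure_pmf.simple_distributedI) (auto simp: simple_function_def pmf_map)
  have fins: "finite (range (\<lambda>w. (Y w, U w)))" "finite (range (\<lambda>w. (X w, U w)))"
    "finite (range (\<lambda>w. (X w, Y w, U w)))"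
    using fin by (auto intro: finite_subset[of _ "range Y \<times> range U"] finite_subset[of _ "range X \<times> range U"]
        finite_subset[of _ "range X \<times> range Y \<times> range U"])
  define h where "h = (\<lambda>(x, y, u). log 2 (pmf (map_pmf (\<lambda>w. (X w, Y w, U w)) p) (x, y, u) /
       (pmf (map_pmf (\<lambda>w. (X w, U w)) p) (x, u) *
         (pmf (map_pmf (\<lambda>w. (Y w, U w)) p) (y, u) / pmf (map_pmf U p) u))))"
  have "cond_mutual_info p X Y U = (\<Sum>t\<in>range (\<lambda>w. (X w, Y w, U w)). pmf (map_pmf (\<lambda>w. (X w, Y w, U w)) p) t * h t)"
    unfolding cond_mutual_info_def
    using conditional_mutual_information_eq[OF sd[OF fin(3)] sd[OF fins(1)] sd[OF fins(2)] sd[OF fins(3)]]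
    by (simp add: h_def case_prod_beta')
  also have "\<dots> = measure_pmf.expectation (map_pmf (\<lambda>w. (X w, Y w, U w)) p) h"
    using fins by (subst integral_measure_pmf_real[where A = "range (\<lambda>w. (X w, Y w, U w))"]) (auto simp: mult.commute)
  finally show ?thesis by (simp add: h_def)
qed

definition output_prob :: "('x::finite, 'y, 's::finite) kernel \<Rightarrow> ('y \<Rightarrow> 'z) \<Rightarrow> ('x, 'z) causal_input \<Rightarrow> 's
    \<Rightarrow> 'y list \<Rightarrow> real" where
  "output_prob W z q s0 ys = (\<Sum>xs | length xs = length ys. causal_prob q xs (map z ys) * channel_prob W s0 xs ys)"

lemma pmf_output_law:
  fixes W :: "('x::finite, 'y::finite, 's::finite) kernel"
  assumes "length ys = N"
  shows "pmf (map_pmf snd (joint_law W z q s0 N)) ys = output_prob W z q s0 ys"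
proof -
  let ?J = "joint_law W z q s0 N" and ?A = "(\<lambda>xs. (xs, ys)) ` {xs. length xs = N}"
  have "pmf (map_pmf snd ?J) ys = measure_pmf.prob ?J (snd -` {ys})" by (simp add: pmf_map)
  also have "\<dots> = measure_pmf.prob ?J ?A"
    by (intro measure_pmf.finite_measure_eq_AE AE_pmfI) (auto dest: set_pmf_joint_law)
  also have "\<dots> = (\<Sum>w\<in>?A. pmf ?J w)"
    by (simp add: measure_measure_pmf_finite)
  also have "\<dots> = (\<Sum>xs | length xs = N. pmf ?J (xs, ys))"
    by (subst sum.reindex) (auto simp: inj_on_def)
  finally show ?thesis using assms by (simp add: pmf_joint_law output_prob_def)
qed

lemma finite_length_le: "finite {xs :: 'a::finite list. length xs \<le> n}"
  using finite_lists_length_le[of "UNIV :: 'a set" n] by simp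

text \<open>The causally conditioned input probabilities cancel in each conditional information density,
  and the remaining ratios telescope.\<close>

lemma directed_info_eq:
  fixes W :: "('x::finite, 'y::finite, 's::finite) kernel"
  shows "directed_info W z N q s0 =
    (\<Sum>ys | length ys = N. \<Sum>xs | length xs = N. causal_prob q xs (map z ys) * channel_prob W s0 xs ys
       * log 2 (channel_prob W s0 xs ys / output_prob W z q s0 ys))"
proof -
  let ?J = "joint_law W z q s0 N"
  define c where "c w i = channel_prob W s0 (take i (fst w)) (take i (snd w))" for w :: "'x list \<times> 'y list" and i
  define b where "b w i = output_prob W z q s0 (take i (snd w))" for w :: "'x list \<times> 'y list" and i
  have fin: "finite (set_pmf ?J)"
    by (rule finite_subset[of _ "{xs. length xs = N} \<times> {ys. length ys = N}"]) (auto dest: set_pmf_joint_law)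
  \<comment> \<open>On the support all prefix probabilities are positive, so quotients may be
    cancelled and logarithms split.\<close>
  have pos: "c w i > 0 \<and> b w i > 0 \<and> causal_prob q (take i (fst w)) (map z (take i (snd w))) > 0"
    if w: "w \<in> set_pmf ?J" and i: "i \<le> N" for w i
  proof -
    obtain xs ys where xy: "w = (xs, ys)" by (cases w)
    have len: "length xs = N" "length ys = N" using set_pmf_joint_law[OF w[unfolded xy]] by auto
    have "(take i xs, take i ys) \<in> set_pmf (joint_law W z q s0 i)"
      unfolding joint_law_take[OF i, symmetric] using w xy by (force simp: set_map_pmf)
    then have mem: "pmf (joint_law W z q s0 i) (take i xs, take i ys) > 0"
      and out: "take i ys \<in> set_pmf (map_pmf snd (joint_law W z q s0 i))"
      by (auto simp: pmf_positive_iff intro!: image_eqI[where x = "(take i xs, take i ys)"])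
    from out have "output_prob W z q s0 (take i ys) > 0"
      using i len by (simp add: pmf_output_law[of _ i, symmetric] pmf_positive)
    with mem show ?thesis
      using i len causal_prob_nonneg[of q "take i xs" "map z (take i ys)"] channel_prob_nonneg[of W s0 "take i xs" "take i ys"]
      by (simp add: pmf_joint_law c_def b_def xy zero_less_mult_iff min_absorb2)
  qed
  have summand: "cond_mutual_info ?J (\<lambda>(xs, ys). take (Suc i) xs) (\<lambda>(xs, ys). ys ! i) (\<lambda>(xs, ys). take i ys) =
      measure_pmf.expectation ?J (\<lambda>w. log 2 (c w (Suc i) / b w (Suc i)) - log 2 (c w i / b w i))"
    if i: "i < N" for i
  proof -
    let ?X = "\<lambda>(xs, ys). take (Suc i) xs" and ?Y = "\<lambda>(xs, ys). ys ! i" and ?U = "\<lambda>(xs, ys). take i ys"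
    have finX: "finite (range (\<lambda>(xs :: 'x list, ys :: 'y list). take (Suc i) xs))"
      by (rule finite_subset[OF _ finite_length_le[where n = "Suc i"]]) auto
    have finU: "finite (range (\<lambda>(xs :: 'x list, ys :: 'y list). take i ys))"
      by (rule finite_subset[OF _ finite_length_le[where n = i]]) auto
    have dens: "pmf (map_pmf (\<lambda>w. (?X w, ?Y w, ?U w)) ?J) (?X w, ?Y w, ?U w) /
       (pmf (map_pmf (\<lambda>w. (?X w, ?U w)) ?J) (?X w, ?U w) *
         (pmf (map_pmf (\<lambda>w. (?Y w, ?U w)) ?J) (?Y w, ?U w) / pmf (map_pmf ?U ?J) (?U w)))
       = (c w (Suc i) / b w (Suc i)) / (c w i / b w i)" if w: "w \<in> set_pmf ?J" for w
    proof -
      obtain xs ys where xy: "w = (xs, ys)" by (cases w)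
      have len: "length xs = N" "length ys = N" using set_pmf_joint_law[OF w[unfolded xy]] by auto
      have snoc: "ys' ! i = ys ! i \<and> take i ys' = take i ys \<longleftrightarrow> take (Suc i) ys' = take (Suc i) ys"
        if "(xs', ys') \<in> set_pmf ?J" for xs' ys'
        using set_pmf_joint_law[OF that] len i by (auto simp: take_Suc_conv_app_nth)
      have takes: "take (Suc i) xs = take i xs @ [xs ! i]" using len i by (simp add: take_Suc_conv_app_nth)
      have 1: "pmf (map_pmf (\<lambda>w. (?X w, ?Y w, ?U w)) ?J) (?X w, ?Y w, ?U w) =
          pmf (joint_law W z q s0 (Suc i)) (take (Suc i) xs, take (Suc i) ys)"
      proof -
        let ?T = "\<lambda>(xs, ys). (take (Suc i) xs, take (Suc i) ys)"
        have "pmf (map_pmf (\<lambda>w. (?X w, ?Y w, ?U w)) ?J) (?X w, ?Y w, ?U w) = pmf (map_pmf ?T ?J) (?T w)"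
        proof (rule pmf_map_eq_if_same_fibre)
          fix v assume "v \<in> set_pmf ?J"
          then show "(?X v, ?Y v, ?U v) = (?X w, ?Y w, ?U w) \<longleftrightarrow> ?T v = ?T w"
            using snoc[of "fst v" "snd v"] by (simp add: xy case_prod_beta')
        qed
        then show ?thesis unfolding joint_law_take[OF Suc_leI[OF i]] by (simp add: xy)
      qed
      have 2: "pmf (map_pmf (\<lambda>w. (?X w, ?U w)) ?J) (?X w, ?U w) =
          causal_prob q (take i xs) (map z (take i ys)) * pmf (q (take i xs) (map z (take i ys))) (xs ! i) * c w i"
        using pmf_joint_law_input_ahead[OF i, of "take i xs" "take i ys" W z q s0 "xs ! i"] len i
        by (simp add: xy c_def takes case_prod_beta' min_def)
      have out: "pmf (map_pmf (\<lambda>(xs, ys). take j ys) ?J) (take j ys) = b w j" if "j \<le> N" for j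
        using that len pmf_output_law[of "take j ys" j W z q s0]
        unfolding joint_law_take[OF that, symmetric]
        by (simp add: b_def xy pmf.map_comp o_def case_prod_beta' min_def)
      have 3: "pmf (map_pmf (\<lambda>w. (?Y w, ?U w)) ?J) (?Y w, ?U w) = b w (Suc i)"
      proof -
        let ?T = "\<lambda>(xs, ys). take (Suc i) ys"
        have "pmf (map_pmf (\<lambda>w. (?Y w, ?U w)) ?J) (?Y w, ?U w) = pmf (map_pmf ?T ?J) (?T w)"
        proof (rule pmf_map_eq_if_same_fibre)
          fix v assume "v \<in> set_pmf ?J"
          then show "(?Y v, ?U v) = (?Y w, ?U w) \<longleftrightarrow> ?T v = ?T w"
            using snoc[of "fst v" "snd v"] by (simp add: xy case_prod_beta')
        qed
        then show ?thesis using out[OF Suc_leI[OF i]] by (simp add: xy)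
      qed
      have 4: "pmf (map_pmf ?U ?J) (?U w) = b w i"
        using out[of i] i by (simp add: xy)
      have 5: "pmf (joint_law W z q s0 (Suc i)) (take (Suc i) xs, take (Suc i) ys) =
          causal_prob q (take i xs) (map z (take i ys)) * pmf (q (take i xs) (map z (take i ys))) (xs ! i) * c w (Suc i)"
        using len i by (simp add: pmf_joint_law c_def xy take_Suc_conv_app_nth causal_prob_snoc)
      have "causal_prob q (take i xs) (map z (take i ys)) * pmf (q (take i xs) (map z (take i ys))) (xs ! i) > 0"
        using pos[OF w Suc_leI[OF i]] len i by (simp add: xy take_Suc_conv_app_nth causal_prob_snoc)
      moreover have "(a * c1) / ((a * c0) * (b1 / b0)) = (c1 / b1) / (c0 / b0)" if "a > 0" for a c1 c0 b1 b0 :: real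
        using that by (simp add: divide_simps)
      ultimately show ?thesis unfolding 1 2 3 4 5 by blast
    qed
    have "cond_mutual_info ?J ?X ?Y ?U = measure_pmf.expectation ?J (\<lambda>w. log 2
      (pmf (map_pmf (\<lambda>w. (?X w, ?Y w, ?U w)) ?J) (?X w, ?Y w, ?U w) /
       (pmf (map_pmf (\<lambda>w. (?X w, ?U w)) ?J) (?X w, ?U w) *
         (pmf (map_pmf (\<lambda>w. (?Y w, ?U w)) ?J) (?Y w, ?U w) / pmf (map_pmf ?U ?J) (?U w)))))"
      by (rule cond_mutual_info_expectation[OF finX _ finU]) simp
    also have "\<dots> = measure_pmf.expectation ?J (\<lambda>w. log 2 (c w (Suc i) / b w (Suc i)) - log 2 (c w i / b w i))"
    proof (rule integral_cong_AE)
      show "AE w in measure_pmf ?J. log 2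
      (pmf (map_pmf (\<lambda>w. (?X w, ?Y w, ?U w)) ?J) (?X w, ?Y w, ?U w) /
       (pmf (map_pmf (\<lambda>w. (?X w, ?U w)) ?J) (?X w, ?U w) *
         (pmf (map_pmf (\<lambda>w. (?Y w, ?U w)) ?J) (?Y w, ?U w) / pmf (map_pmf ?U ?J) (?U w)))) =
         log 2 (c w (Suc i) / b w (Suc i)) - log 2 (c w i / b w i)"
      proof (rule AE_pmfI)
        fix w assume w: "w \<in> set_pmf ?J"
        show "log 2
      (pmf (map_pmf (\<lambda>w. (?X w, ?Y w, ?U w)) ?J) (?X w, ?Y w, ?U w) /
       (pmf (map_pmf (\<lambda>w. (?X w, ?U w)) ?J) (?X w, ?U w) *
         (pmf (map_pmf (\<lambda>w. (?Y w, ?U w)) ?J) (?Y w, ?U w) / pmf (map_pmf ?U ?J) (?U w)))) =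
         log 2 (c w (Suc i) / b w (Suc i)) - log 2 (c w i / b w i)"
          unfolding dens[OF w] using pos[OF w, of i] pos[OF w, of "Suc i"] i by (subst log_divide) auto
      qed
    qed auto
    finally show ?thesis .
  qed
  have "directed_info W z N q s0 = (\<Sum>i<N. cond_mutual_info ?J
      (\<lambda>(xs, ys). take (Suc i) xs) (\<lambda>(xs, ys). ys ! i) (\<lambda>(xs, ys). take i ys))"
    unfolding directed_info_def
    by (rule sum.reindex_bij_witness[of _ Suc "\<lambda>i. i - 1"]) auto
  also have "\<dots> = (\<Sum>i<N. measure_pmf.expectation ?J (\<lambda>w. log 2 (c w (Suc i) / b w (Suc i)) - log 2 (c w i / b w i)))"
    using summand by simp
  also have "\<dots> = measure_pmf.expectation ?J (\<lambda>w. \<Sum>i<N. log 2 (c w (Suc i) / b w (Suc i)) - log 2 (c w i / b w i))"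
    by (rule Bochner_Integration.integral_sum[symmetric]) (rule integrable_measure_pmf_finite[OF fin])
  also have "\<dots> = measure_pmf.expectation ?J (\<lambda>w. log 2 (c w N / b w N) - log 2 (c w 0 / b w 0))"
    by (simp only: sum_lessThan_telescope[where f = "\<lambda>i. log 2 (c w i / b w i)" for w])
  \<comment> \<open>The term left over at index 0 is the logarithm of 1: both probabilities of the
    empty prefix are 1.\<close>
  also have "\<dots> = (\<Sum>ys | length ys = N. \<Sum>xs | length xs = N. causal_prob q xs (map z ys) * channel_prob W s0 xs ys
       * log 2 (channel_prob W s0 xs ys / output_prob W z q s0 ys))"
    unfolding expectation_joint_law
    by (intro sum.cong) (auto simp: c_def b_def output_prob_def causal_prob_def channel_prob_def path_prob_def)
  finally show ?thesis .
qed

section \<open>The exponent for small \<open>\<rho>\<close>\<close>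

lemma output_prob_nonneg: "output_prob W z q s0 ys \<ge> 0"
  unfolding output_prob_def by (intro sum_nonneg mult_nonneg_nonneg causal_prob_nonneg channel_prob_nonneg)

lemma sum_output_prob:
  fixes W :: "('x::finite, 'y::finite, 's::finite) kernel"
  shows "(\<Sum>ys | length ys = N. output_prob W z q s0 ys) = 1"
proof -
  have "(\<Sum>ys | length ys = N. output_prob W z q s0 ys) =
      (\<Sum>ys | length ys = N. \<Sum>xs | length xs = N. causal_prob q xs (map z ys) * channel_prob W s0 xs ys)"
    by (intro sum.cong) (auto simp: output_prob_def)
  then show ?thesis by (simp add: sum_joint_prob)
qed

text \<open>Since channel probabilities are at most 1, taking the root 1 / (1 + \<rho>) increases
  them, so the inner sums add up to at least 1. The power mean inequality over all output sequences
  gives the bound. It keeps the sum away from 0, as the logarithm needs, and bounds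
  \<open>E_o\<close> from above.\<close>

lemma gallager_sum_ge:
  fixes W :: "('x::finite, 'y::finite, 's::finite) kernel"
  assumes \<rho>: "\<rho> \<ge> 0"
  shows "real CARD('y) powr (- \<rho> * real N) \<le> gallager_sum W z N \<rho> q s0"
proof -
  define u where "u ys = (\<Sum>xs | length xs = N. causal_prob q xs (map z ys) * channel_prob W s0 xs ys powr (1 / (1 + \<rho>)))" for ys
  have u0: "u ys \<ge> 0" for ys unfolding u_def by (intro sum_nonneg) (simp add: causal_prob_nonneg)
  have Y: "real CARD('y) > 0" by simp
  have "1 = (\<Sum>ys | length ys = N. \<Sum>xs | length xs = N. causal_prob q xs (map z ys) * channel_prob W s0 xs ys)"
    by (rule sum_joint_prob[symmetric])
  also have "\<dots> \<le> (\<Sum>ys | length ys = N. u ys)"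
    unfolding u_def
  proof (intro sum_mono mult_left_mono)
    fix ys :: "'y list" and xs :: "'x list" assume "ys \<in> {ys. length ys = N}" "xs \<in> {xs. length xs = N}"
    then have "channel_prob W s0 xs ys powr 1 \<le> channel_prob W s0 xs ys powr (1 / (1 + \<rho>))"
      using \<rho> by (intro powr_mono') (auto simp: channel_prob_nonneg channel_prob_le_1)
    then show "channel_prob W s0 xs ys \<le> channel_prob W s0 xs ys powr (1 / (1 + \<rho>))"
      by (simp add: channel_prob_nonneg)
  qed (simp add: causal_prob_nonneg)
  finally have "1 powr (1 + \<rho>) \<le> (\<Sum>ys | length ys = N. u ys) powr (1 + \<rho>)"
    using \<rho> by (intro powr_mono2) auto
  also have "\<dots> \<le> real (card {ys :: 'y list. length ys = N}) powr (1 + \<rho> - 1) * (\<Sum>ys | length ys = N. u ys powr (1 + \<rho>))"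
    using \<rho> u0 by (intro sum_powr_le length_eq_nonempty) auto
  also have "\<dots> = real CARD('y) powr (\<rho> * real N) * gallager_sum W z N \<rho> q s0"
    using Y by (simp add: card_length_eq gallager_sum_def u_def powr_realpow[symmetric] powr_powr mult.commute)
  finally have "1 \<le> real CARD('y) powr (\<rho> * real N) * gallager_sum W z N \<rho> q s0" by simp
  then show ?thesis using Y by (simp add: powr_minus field_simps)
qed

lemma gallager_sum_pos:
  fixes W :: "('x::finite, 'y::finite, 's::finite) kernel"
  assumes "\<rho> \<ge> 0"
  shows "gallager_sum W z N \<rho> q s0 > 0"
  using gallager_sum_ge[OF assms, of N W z q s0] by (smt (verit) powr_gt_zero of_nat_0_less_iff zero_less_card_finite)

lemma gallager_sum_E_o:
  fixes W :: "('x::finite, 'y::finite, 's::finite) kernel"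
  assumes "\<rho> \<ge> 0" "N \<ge> 1"
  shows "gallager_sum W z N \<rho> q s0 = 2 powr (- (real N * E_o W z N \<rho> q s0))"
  using assms gallager_sum_pos[OF assms(1), of W z N q s0] by (simp add: E_o_gallager_sum)

lemma E_o_le:
  fixes W :: "('x::finite, 'y::finite, 's::finite) kernel"
  assumes "\<rho> \<ge> 0" "N \<ge> 1"
  shows "E_o W z N \<rho> q s0 \<le> \<rho> * log 2 (real CARD('y))"
proof -
  have "log 2 (real CARD('y) powr (- \<rho> * real N)) \<le> log 2 (gallager_sum W z N \<rho> q s0)"
    using gallager_sum_ge[OF assms(1), of N W z q s0] by (intro log_mono) auto
  then have "- (\<rho> * real N * log 2 (real CARD('y))) \<le> log 2 (gallager_sum W z N \<rho> q s0)"
    by (simp add: log_powr)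
  then show ?thesis using assms by (simp add: E_o_gallager_sum field_simps)
qed

text \<open>The scaled exponent stays below its tangent at \<rho> = 0. Two applications of the log
  sum inequality, over inputs and then over outputs, show this without second derivatives.\<close>

lemma E_o_le_directed_info:
  fixes W :: "('x::finite, 'y::finite, 's::finite) kernel"
  assumes \<rho>: "\<rho> \<ge> 0" and N: "N \<ge> 1"
  shows "real N * E_o W z N \<rho> q s0 \<le> \<rho> * directed_info W z N q s0"
proof -
  define Q where "Q xs ys = causal_prob q xs (map z ys)" for xs ys
  define P where "P xs ys = channel_prob W s0 xs ys" for xs ys
  define p where "p ys = output_prob W z q s0 ys" for ys
  define u where "u ys = (\<Sum>xs | length xs = N. Q xs ys * P xs ys powr (1 / (1 + \<rho>)))" for ys
  have nn: "Q xs ys \<ge> 0" "P xs ys \<ge> 0" "p ys \<ge> 0" for xs ys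
    by (auto simp: Q_def P_def p_def causal_prob_nonneg channel_prob_nonneg output_prob_nonneg)
  have u0: "u ys \<ge> 0" for ys unfolding u_def by (intro sum_nonneg) (simp add: nn)
  have p_sum: "p ys = (\<Sum>xs | length xs = N. Q xs ys * P xs ys)" if "length ys = N" for ys
    using that by (simp add: p_def output_prob_def Q_def P_def)
  have upos: "u ys > 0" if "length ys = N" "p ys > 0" for ys
  proof (rule ccontr)
    assume "\<not> u ys > 0"
    then have "u ys = 0" using u0[of ys] by simp
    then have "Q xs ys * P xs ys powr (1 / (1 + \<rho>)) = 0" if "length xs = N" for xs
      using sum_nonneg_eq_0_iff[of "{xs :: 'x list. length xs = N}" "\<lambda>xs. Q xs ys * P xs ys powr (1 / (1 + \<rho>))"] nn that
      by (simp add: u_def)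
    then have "p ys = 0" unfolding p_sum[OF that(1)] by (intro sum.neutral) auto
    then show False using that by simp
  qed
  have inner: "- \<rho> * (\<Sum>xs | length xs = N. Q xs ys * P xs ys * ln (P xs ys / p ys))
      \<le> p ys * ln (u ys powr (1 + \<rho>) / p ys)" if len: "length ys = N" for ys
  proof (cases "p ys = 0")
    case True
    then have "Q xs ys * P xs ys = 0" if "length xs = N" for xs
      using p_sum[OF len] nn that sum_nonneg_eq_0_iff[of "{xs :: 'x list. length xs = N}" "\<lambda>xs. Q xs ys * P xs ys"]
      by simp
    then have "(\<Sum>xs | length xs = N. Q xs ys * P xs ys * ln (P xs ys / p ys)) = 0" by (intro sum.neutral) auto
    then show ?thesis using True by simp
  next
    case False
    then have p: "p ys > 0" using nn(3)[of ys] by simp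
    note u = upos[OF len p]
    \<comment> \<open>Log sum inequality over xs at fixed ys, comparing the joint mass Q P with its
      tilted version; the factor Q cancels in the ratio and a multiple of ln P remains.\<close>
    have "(\<Sum>xs | length xs = N. Q xs ys * P xs ys * ln (Q xs ys * P xs ys powr (1 / (1 + \<rho>)) / (Q xs ys * P xs ys)))
       \<le> p ys * ln (u ys / p ys)"
      unfolding u_def p_sum[OF len] using nn by (intro log_sum_le) (auto simp: zero_less_mult_iff less_le)
    also have "(\<Sum>xs | length xs = N. Q xs ys * P xs ys * ln (Q xs ys * P xs ys powr (1 / (1 + \<rho>)) / (Q xs ys * P xs ys)))
       = (\<Sum>xs | length xs = N. - (\<rho> / (1 + \<rho>)) * (Q xs ys * P xs ys * ln (P xs ys)))"
    proof (intro sum.cong refl)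
      fix xs
      show "Q xs ys * P xs ys * ln (Q xs ys * P xs ys powr (1 / (1 + \<rho>)) / (Q xs ys * P xs ys))
          = - (\<rho> / (1 + \<rho>)) * (Q xs ys * P xs ys * ln (P xs ys))"
      proof (cases "Q xs ys * P xs ys = 0")
        case False
        then have pos: "Q xs ys > 0" "P xs ys > 0" using nn(1)[of xs ys] nn(2)[of xs ys] by auto
        then have "ln (Q xs ys * P xs ys powr (1 / (1 + \<rho>)) / (Q xs ys * P xs ys)) = (1 / (1 + \<rho>) - 1) * ln (P xs ys)"
          by (simp add: ln_div ln_powr algebra_simps)
        also have "1 / (1 + \<rho>) - 1 = - (\<rho> / (1 + \<rho>))" using \<rho> by (simp add: field_simps)
        finally show ?thesis by simp
      qed auto
    qed
    finally have "(1 + \<rho>) * (\<Sum>xs | length xs = N. - (\<rho> / (1 + \<rho>)) * (Q xs ys * P xs ys * ln (P xs ys)))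
       \<le> (1 + \<rho>) * (p ys * ln (u ys / p ys))"
      using \<rho> by (intro mult_left_mono) auto
    also have "(1 + \<rho>) * (\<Sum>xs | length xs = N. - (\<rho> / (1 + \<rho>)) * (Q xs ys * P xs ys * ln (P xs ys)))
        = - \<rho> * (\<Sum>xs | length xs = N. Q xs ys * P xs ys * ln (P xs ys))"
      unfolding sum_distrib_left[symmetric] using \<rho> by simp
    finally have le: "- \<rho> * (\<Sum>xs | length xs = N. Q xs ys * P xs ys * ln (P xs ys)) \<le> (1 + \<rho>) * (p ys * ln (u ys / p ys))" .
    have "(\<Sum>xs | length xs = N. Q xs ys * P xs ys * ln (P xs ys / p ys)) =
        (\<Sum>xs | length xs = N. Q xs ys * P xs ys * ln (P xs ys) - Q xs ys * P xs ys * ln (p ys))"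
    proof (intro sum.cong refl)
      fix xs
      show "Q xs ys * P xs ys * ln (P xs ys / p ys) = Q xs ys * P xs ys * ln (P xs ys) - Q xs ys * P xs ys * ln (p ys)"
        using p nn(2)[of xs ys] by (cases "P xs ys = 0") (auto simp: ln_div algebra_simps)
    qed
    also have "\<dots> = (\<Sum>xs | length xs = N. Q xs ys * P xs ys * ln (P xs ys)) - p ys * ln (p ys)"
      by (simp add: sum_subtractf p_sum[OF len] sum_distrib_right)
    finally have eq: "(\<Sum>xs | length xs = N. Q xs ys * P xs ys * ln (P xs ys / p ys)) =
        (\<Sum>xs | length xs = N. Q xs ys * P xs ys * ln (P xs ys)) - p ys * ln (p ys)" .
    have "ln (u ys powr (1 + \<rho>) / p ys) = (1 + \<rho>) * ln (u ys / p ys) + \<rho> * ln (p ys)"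
      using p u by (simp add: ln_div ln_powr algebra_simps)
    then have "p ys * ln (u ys powr (1 + \<rho>) / p ys) = (1 + \<rho>) * (p ys * ln (u ys / p ys)) + \<rho> * (p ys * ln (p ys))"
      by (simp add: algebra_simps)
    with le show ?thesis unfolding eq by (simp add: algebra_simps)
  qed
  have "- \<rho> * ln 2 * directed_info W z N q s0 =
      (\<Sum>ys | length ys = N. - \<rho> * (\<Sum>xs | length xs = N. Q xs ys * P xs ys * ln (P xs ys / p ys)))"
    by (simp add: directed_info_eq Q_def P_def p_def log_def sum_distrib_left mult.assoc)
  also have "\<dots> \<le> (\<Sum>ys | length ys = N. p ys * ln (u ys powr (1 + \<rho>) / p ys))"
    by (intro sum_mono inner) auto
  \<comment> \<open>Second application, over ys; the output probabilities sum to 1, so only the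
    Gallager sum is left inside the logarithm.\<close>
  also have "\<dots> \<le> (\<Sum>ys | length ys = N. p ys) * ln ((\<Sum>ys | length ys = N. u ys powr (1 + \<rho>)) / (\<Sum>ys | length ys = N. p ys))"
    using nn u0 upos by (intro log_sum_le) fastforce+
  also have "\<dots> = ln (gallager_sum W z N \<rho> q s0)"
    by (simp add: p_def sum_output_prob gallager_sum_def u_def Q_def P_def)
  finally show ?thesis using N by (simp add: E_o_gallager_sum log_def field_simps)
qed

text \<open>At \<rho> = 0 the inner sum u equals the output probability p, so the derivative of
  \<open>u powr (1 + \<rho>)\<close> there is p ln p plus the derivative of u, which is minus the
  sum of Q P ln P. Together they give minus the sum of Q P ln (P / p).\<close>

lemma gallager_sum_deriv:
  fixes W :: "('x::finite, 'y::finite, 's::finite) kernel"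
  shows "((\<lambda>\<rho>. gallager_sum W z N \<rho> q s0) has_real_derivative - ln 2 * directed_info W z N q s0) (at 0)"
proof -
  define Q where "Q xs ys = causal_prob q xs (map z ys)" for xs ys
  define P where "P xs ys = channel_prob W s0 xs ys" for xs ys
  define p where "p ys = output_prob W z q s0 ys" for ys
  define u where "u ys \<rho> = (\<Sum>xs | length xs = N. Q xs ys * P xs ys powr (1 / (1 + \<rho>)))" for ys \<rho>
  have nn: "Q xs ys \<ge> 0" "P xs ys \<ge> 0" "p ys \<ge> 0" for xs ys
    by (auto simp: Q_def P_def p_def causal_prob_nonneg channel_prob_nonneg output_prob_nonneg)
  have p_sum: "p ys = (\<Sum>xs | length xs = N. Q xs ys * P xs ys)" if "length ys = N" for ys
    using that by (simp add: p_def output_prob_def Q_def P_def)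
  have base: "((\<lambda>\<rho>. P xs ys powr (1 / (1 + \<rho>))) has_real_derivative - (P xs ys * ln (P xs ys))) (at 0)" for xs ys
  proof (cases "P xs ys = 0")
    case False
    then have "P xs ys > 0" using nn(2)[of xs ys] by simp
    then show ?thesis by (auto simp: powr_def intro!: derivative_eq_intros)
  qed simp
  have inner: "((\<lambda>\<rho>. u ys \<rho> powr (1 + \<rho>)) has_real_derivative
      - (\<Sum>xs | length xs = N. Q xs ys * P xs ys * ln (P xs ys / p ys))) (at 0)" if len: "length ys = N" for ys
  proof (cases "p ys = 0")
    case True
    then have z: "Q xs ys * P xs ys = 0" if "length xs = N" for xs
      using p_sum[OF len] nn that sum_nonneg_eq_0_iff[of "{xs :: 'x list. length xs = N}" "\<lambda>xs. Q xs ys * P xs ys"]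
      by simp
    then have "(\<Sum>xs | length xs = N. Q xs ys * P xs ys * ln (P xs ys / p ys)) = 0" by (intro sum.neutral) auto
    \<comment> \<open>An output of probability 0 contributes 0 for every \<rho>; this case is
      separate because the power rule needs a positive base.\<close>
    moreover have "u ys \<rho> = 0" for \<rho> unfolding u_def using z by (intro sum.neutral) auto
    ultimately show ?thesis by simp
  next
    case False
    then have p: "p ys > 0" using nn(3)[of ys] by simp
    have u0: "u ys 0 = p ys" using nn by (simp add: u_def p_sum[OF len])
    have "(u ys has_real_derivative (\<Sum>xs | length xs = N. Q xs ys * - (P xs ys * ln (P xs ys)))) (at 0)"
      unfolding u_def by (intro DERIV_sum DERIV_cmult base)
    then have "((\<lambda>\<rho>. u ys \<rho> powr (1 + \<rho>)) has_real_derivative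
        u ys 0 powr (1 + 0) * (1 * ln (u ys 0) + (\<Sum>xs | length xs = N. Q xs ys * - (P xs ys * ln (P xs ys))) * (1 + 0) / u ys 0)) (at 0)"
      using p u0 by (intro DERIV_powr) (auto intro!: derivative_eq_intros)
    moreover have "u ys 0 powr (1 + 0) * (1 * ln (u ys 0) + (\<Sum>xs | length xs = N. Q xs ys * - (P xs ys * ln (P xs ys))) * (1 + 0) / u ys 0)
        = p ys * ln (p ys) - (\<Sum>xs | length xs = N. Q xs ys * P xs ys * ln (P xs ys))"
      using p by (simp add: u0 field_simps sum_negf)
    moreover have "\<dots> = (\<Sum>xs | length xs = N. Q xs ys * P xs ys * ln (p ys) - Q xs ys * P xs ys * ln (P xs ys))"
      by (simp add: sum_subtractf p_sum[OF len] sum_distrib_right)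
    moreover have "\<dots> = - (\<Sum>xs | length xs = N. Q xs ys * P xs ys * ln (P xs ys / p ys))"
      unfolding sum_negf[symmetric]
    proof (intro sum.cong refl)
      fix xs
      show "Q xs ys * P xs ys * ln (p ys) - Q xs ys * P xs ys * ln (P xs ys) = - (Q xs ys * P xs ys * ln (P xs ys / p ys))"
        using p nn(2)[of xs ys] by (cases "P xs ys = 0") (auto simp: ln_div algebra_simps)
    qed
    ultimately show ?thesis by simp
  qed
  have "((\<lambda>\<rho>. \<Sum>ys | length ys = N. u ys \<rho> powr (1 + \<rho>)) has_real_derivative
      (\<Sum>ys | length ys = N. - (\<Sum>xs | length xs = N. Q xs ys * P xs ys * ln (P xs ys / p ys)))) (at 0)"
    by (intro DERIV_sum inner) auto
  moreover have "(\<Sum>ys | length ys = N. - (\<Sum>xs | length xs = N. Q xs ys * P xs ys * ln (P xs ys / p ys)))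
      = - ln 2 * directed_info W z N q s0"
    by (simp add: directed_info_eq Q_def P_def p_def log_def sum_distrib_left sum_negf)
  ultimately show ?thesis
    by (simp add: gallager_sum_def u_def Q_def P_def)
qed

text \<open>The Gallager sum is 1 at \<rho> = 0, so its negative logarithm vanishes there and the
  quotient is a difference quotient.\<close>

lemma E_o_over_rho_tendsto:
  fixes W :: "('x::finite, 'y::finite, 's::finite) kernel"
  assumes N: "N \<ge> 1"
  shows "((\<lambda>\<rho>. real N * E_o W z N \<rho> q s0 / \<rho>) \<longlongrightarrow> directed_info W z N q s0) (at_right 0)"
proof -
  have G0: "gallager_sum W z N 0 q s0 = 1"
    using sum_joint_prob[of q z W s0 N]
    by (simp add: gallager_sum_def channel_prob_nonneg causal_prob_nonneg sum_nonneg)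
  have "((\<lambda>\<rho>. - log 2 (gallager_sum W z N \<rho> q s0)) has_real_derivative directed_info W z N q s0) (at 0)"
    using G0 by (auto simp: log_def intro!: derivative_eq_intros gallager_sum_deriv)
  then have "((\<lambda>\<rho>. (- log 2 (gallager_sum W z N \<rho> q s0)) / \<rho>) \<longlongrightarrow> directed_info W z N q s0) (at 0)"
    using G0 by (simp add: has_field_derivative_iff)
  then have "((\<lambda>\<rho>. (- log 2 (gallager_sum W z N \<rho> q s0)) / \<rho>) \<longlongrightarrow> directed_info W z N q s0) (at_right 0)"
    by (rule tendsto_mono[rotated]) (simp add: at_le)
  then show ?thesis using N by (simp add: E_o_gallager_sum)
qed

section \<open>Limits over the block length\<close>

text \<open>The logarithm of the concatenation bound. The minimum is taken only over the state
  entering the second block, as that state is random; the initial state s0 stays fixed.\<close>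

lemma E_o_concat_input:
  fixes W :: "('x::finite, 'y::finite, 's::finite) kernel"
  assumes \<rho>: "\<rho> \<ge> 0" and n: "n \<ge> 1" and l: "l \<ge> 1"
  shows "real n * E_o W z n \<rho> q1 s0 + real l * (MIN s. E_o W z l \<rho> q2 s) - \<rho> * log 2 (real CARD('s))
    \<le> real (n + l) * E_o W z (n + l) \<rho> (concat_input n q1 q2) s0"
proof -
  let ?m = "MIN s. E_o W z l \<rho> q2 s"
  have "gallager_sum W z l \<rho> q2 s \<le> 2 powr (- (real l * ?m))" for s
    using \<rho> l by (simp add: gallager_sum_E_o)
  then have "gallager_sum W z (n + l) \<rho> (concat_input n q1 q2) s0
      \<le> real CARD('s) powr \<rho> * gallager_sum W z n \<rho> q1 s0 * 2 powr (- (real l * ?m))"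
    by (intro gallager_sum_concat_input \<rho>)
  then have "2 powr (- (real (n + l) * E_o W z (n + l) \<rho> (concat_input n q1 q2) s0))
      \<le> 2 powr (\<rho> * log 2 (real CARD('s))) * 2 powr (- (real n * E_o W z n \<rho> q1 s0)) * 2 powr (- (real l * ?m))"
    using \<rho> n l by (simp add: gallager_sum_E_o powr_powr[symmetric] mult.commute[of \<rho>])
  then have "2 powr (- (real (n + l) * E_o W z (n + l) \<rho> (concat_input n q1 q2) s0))
      \<le> 2 powr (\<rho> * log 2 (real CARD('s)) - real n * E_o W z n \<rho> q1 s0 - real l * ?m)"
    by (simp add: powr_add[symmetric])
  then show ?thesis by simp
qed

lemma SUP_add_SUP_le:
  fixes f :: "'a \<Rightarrow> real" and g :: "'b \<Rightarrow> real"
  assumes a: "a > 0" and b: "b > 0" and le: "\<And>x y. a * f x + b * g y \<le> K"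
  shows "a * (SUP x. f x) + b * (SUP y. g y) \<le> K"
proof -
  have "(SUP x. f x) \<le> (K - b * g y) / a" for y
    using a le[of _ y] by (intro cSUP_least) (auto simp: field_simps)
  then have "(SUP y. g y) \<le> (K - a * (SUP x. f x)) / b"
    using a b by (intro cSUP_least) (auto simp: field_simps)
  then show ?thesis using b by (simp add: field_simps)
qed

lemma Min_E_o_le:
  fixes W :: "('x::finite, 'y::finite, 's::finite) kernel"
  assumes "\<rho> \<ge> 0" "N \<ge> 1"
  shows "(MIN s0. E_o W z N \<rho> q s0) \<le> \<rho> * log 2 (real CARD('y))"
  by (rule order_trans[OF Min_le E_o_le[OF assms, of W z q undefined]]) auto

lemma bdd_above_Min_E_o:
  fixes W :: "('x::finite, 'y::finite, 's::finite) kernel"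
  assumes "\<rho> \<ge> 0" "N \<ge> 1"
  shows "bdd_above (range (\<lambda>q. MIN s0. E_o W z N \<rho> q s0))"
  using Min_E_o_le[OF assms] by (intro bdd_aboveI2)

text \<open>Multiplied by the block length, the correction in \<open>F_N\<close> does not depend on
  the length. Two blocks carry it twice and their concatenation once; the surplus covers the cost of
  the boundary state.\<close>

lemma F_N_superadditive:
  fixes W :: "('x::finite, 'y::finite, 's::finite) kernel" and z :: "'y \<Rightarrow> 'z"
  assumes \<rho>: "\<rho> \<ge> 0" and n: "n \<ge> 1" and l: "l \<ge> 1"
  shows "real n * F_N W z n \<rho> + real l * F_N W z l \<rho> \<le> real (n + l) * F_N W z (n + l) \<rho>"
proof -
  let ?S = "\<rho> * log 2 (real CARD('s))"
  have F: "real k * F_N W z k \<rho> = real k * (SUP q. MIN s0. E_o W z k \<rho> q s0) - ?S" if "k \<ge> 1" for k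
    using that by (simp add: F_N_def field_simps)
  have bdd: "bdd_above (range (\<lambda>q :: ('x, 'z) causal_input. MIN s0. E_o W z (n + l) \<rho> q s0))"
    using n by (intro bdd_above_Min_E_o \<rho>) auto
  have "real n * (SUP q. MIN s0. E_o W z n \<rho> q s0) + real l * (SUP q. MIN s0. E_o W z l \<rho> q s0)
      \<le> real (n + l) * (SUP q. MIN s0. E_o W z (n + l) \<rho> q s0) + ?S"
  proof (rule SUP_add_SUP_le)
    fix q1 q2 :: "('x, 'z) causal_input"
    \<comment> \<open>The minimum over the finitely many states is attained, so the bound at a
      single s0 suffices.\<close>
    have "(MIN s0. E_o W z (n + l) \<rho> (concat_input n q1 q2) s0) \<in> range (E_o W z (n + l) \<rho> (concat_input n q1 q2))"
      by (intro Min_in) auto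
    then obtain s0 where s0: "(MIN s0. E_o W z (n + l) \<rho> (concat_input n q1 q2) s0) = E_o W z (n + l) \<rho> (concat_input n q1 q2) s0"
      by blast
    have "real n * (MIN s0. E_o W z n \<rho> q1 s0) + real l * (MIN s0. E_o W z l \<rho> q2 s0) - ?S
        \<le> real n * E_o W z n \<rho> q1 s0 + real l * (MIN s0. E_o W z l \<rho> q2 s0) - ?S"
      by (simp add: mult_left_mono)
    also have "\<dots> \<le> real (n + l) * E_o W z (n + l) \<rho> (concat_input n q1 q2) s0"
      by (rule E_o_concat_input[OF \<rho> n l])
    also have "\<dots> = real (n + l) * (MIN s0. E_o W z (n + l) \<rho> (concat_input n q1 q2) s0)"
      using s0 by simp
    also have "\<dots> \<le> real (n + l) * (SUP q. MIN s0. E_o W z (n + l) \<rho> q s0)"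
      using bdd by (intro mult_left_mono cSUP_upper) auto
    finally show "real n * (MIN s0. E_o W z n \<rho> q1 s0) + real l * (MIN s0. E_o W z l \<rho> q2 s0)
        \<le> real (n + l) * (SUP q. MIN s0. E_o W z (n + l) \<rho> q s0) + ?S" by simp
  qed (use n l in auto)
  then show ?thesis using n F[OF n] F[OF l] F[of "n + l"] by linarith
qed

lemma F_N_le:
  fixes W :: "('x::finite, 'y::finite, 's::finite) kernel"
  assumes "\<rho> \<ge> 0" "N \<ge> 1"
  shows "F_N W z N \<rho> \<le> \<rho> * log 2 (real CARD('y))"
proof -
  have "(SUP q. MIN s0. E_o W z N \<rho> q s0) \<le> \<rho> * log 2 (real CARD('y))"
    using Min_E_o_le[OF assms] by (intro cSUP_least) auto
  moreover have "\<rho> * log 2 (real CARD('s)) / real N \<ge> 0"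
    using assms by (simp add: Suc_leI)
  ultimately show ?thesis unfolding F_N_def by linarith
qed

lemma bdd_above_F_N:
  fixes W :: "('x::finite, 'y::finite, 's::finite) kernel"
  assumes "\<rho> \<ge> 0"
  shows "bdd_above ((\<lambda>N. F_N W z N \<rho>) ` {1..})"
  using F_N_le[OF assms] by (intro bdd_aboveI2) auto

lemma F_N_tendsto_F_inf:
  fixes W :: "('x::finite, 'y::finite, 's::finite) kernel"
  assumes "\<rho> \<ge> 0"
  shows "(\<lambda>N. F_N W z N \<rho>) \<longlonglongrightarrow> F_inf W z \<rho>"
proof -
  have eq: "real n * F_N W z n \<rho> / real n = F_N W z n \<rho>" if "n \<ge> 1" for n
    using that by simp
  have im: "(\<lambda>n. real n * F_N W z n \<rho> / real n) ` {1..} = (\<lambda>N. F_N W z N \<rho>) ` {1..}"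
    by (intro image_cong) auto
  have "(\<lambda>n. real n * F_N W z n \<rho> / real n) \<longlonglongrightarrow> (SUP n\<in>{1..}. real n * F_N W z n \<rho> / real n)"
    using F_N_superadditive[OF assms] bdd_above_F_N[OF assms] unfolding im[symmetric]
    by (intro superadditive_tendsto_SUP) auto
  then show ?thesis
    unfolding F_inf_def im
    by (rule Lim_transform_eventually) (use eq in \<open>auto simp: eventually_sequentially\<close>)
qed

lemma F_inf_le:
  fixes W :: "('x::finite, 'y::finite, 's::finite) kernel"
  assumes "\<rho> \<ge> 0"
  shows "F_inf W z \<rho> \<le> \<rho> * log 2 (real CARD('y))"
  unfolding F_inf_def using F_N_le[OF assms] by (intro cSUP_least) auto

lemma bdd_above_E_r:
  fixes W :: "('x::finite, 'y::finite, 's::finite) kernel"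
  assumes "R \<ge> 0"
  shows "bdd_above ((\<lambda>\<rho>. F_inf W z \<rho> - \<rho> * R) ` {0..1})"
proof (intro bdd_aboveI2)
  fix \<rho> :: real assume \<rho>: "\<rho> \<in> {0..1}"
  have "\<rho> * log 2 (real CARD('y)) \<le> 1 * log 2 (real CARD('y))"
    using \<rho> by (intro mult_right_mono) (auto simp: Suc_leI)
  moreover have "\<rho> * R \<ge> 0" using \<rho> assms by simp
  ultimately show "F_inf W z \<rho> - \<rho> * R \<le> log 2 (real CARD('y))"
    using F_inf_le[of \<rho> W z] \<rho> by simp
qed

text \<open>Finitely many states: one threshold for \<rho> serves all of them, so the limit passes
  through the minimum.\<close>

lemma eventually_Min_E_o_ge:
  fixes W :: "('x::finite, 'y::finite, 's::finite) kernel"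
  assumes N: "N \<ge> 1" and e: "e > 0"
  shows "\<forall>\<^sub>F \<rho> in at_right 0. \<rho> * ((MIN s. directed_info W z N q s) - e) \<le> real N * (MIN s. E_o W z N \<rho> q s)"
proof -
  have "\<forall>\<^sub>F \<rho> in at_right 0. directed_info W z N q s - e < real N * E_o W z N \<rho> q s / \<rho>" for s
    using e by (intro order_tendstoD(1)[OF E_o_over_rho_tendsto[OF N]]) simp
  then have "\<forall>\<^sub>F \<rho> in at_right 0. \<forall>s. directed_info W z N q s - e < real N * E_o W z N \<rho> q s / \<rho>"
    by (rule eventually_all_finite)
  moreover have "\<forall>\<^sub>F \<rho> in at_right (0::real). \<rho> > 0" by (rule eventually_at_right_less)
  ultimately show ?thesis
  proof eventually_elim
    case (elim \<rho>)
    have "(MIN s. E_o W z N \<rho> q s) \<in> range (E_o W z N \<rho> q)" by (intro Min_in) auto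
    then obtain s where s: "(MIN s. E_o W z N \<rho> q s) = E_o W z N \<rho> q s" by blast
    have "(MIN s. directed_info W z N q s) - e \<le> directed_info W z N q s - e" by simp
    also have "\<dots> \<le> real N * E_o W z N \<rho> q s / \<rho>" using elim by (simp add: less_imp_le)
    finally show ?case using elim(2) unfolding s by (simp add: field_simps)
  qed
qed

text \<open>No entropy calculus is used. For one sufficiently small \<rho> each block's exponent is
  within \<open>\<rho> * e / 2\<close> of its linearization; concatenate the exponents, bound the
  result from above by \<rho> times the directed information, and divide by \<rho>.\<close>

lemma directed_info_concat_input:
  fixes W :: "('x::finite, 'y::finite, 's::finite) kernel"
  assumes n: "n \<ge> 1" and l: "l \<ge> 1"
  shows "(MIN s. directed_info W z n q1 s) + (MIN s. directed_info W z l q2 s) - log 2 (real CARD('s))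
    \<le> directed_info W z (n + l) (concat_input n q1 q2) s0"
proof (rule field_le_epsilon)
  fix e :: real assume e: "e > 0"
  let ?I1 = "MIN s. directed_info W z n q1 s" and ?I2 = "MIN s. directed_info W z l q2 s"
  have "\<forall>\<^sub>F \<rho> in at_right 0. \<rho> * (?I1 - e / 2) \<le> real n * (MIN s. E_o W z n \<rho> q1 s)
      \<and> \<rho> * (?I2 - e / 2) \<le> real l * (MIN s. E_o W z l \<rho> q2 s) \<and> \<rho> > 0"
    using e by (intro eventually_conj eventually_Min_E_o_ge n l eventually_at_right_less) auto
  then obtain \<rho> where \<rho>: "\<rho> * (?I1 - e / 2) \<le> real n * (MIN s. E_o W z n \<rho> q1 s)"
      "\<rho> * (?I2 - e / 2) \<le> real l * (MIN s. E_o W z l \<rho> q2 s)" "\<rho> > 0"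
    using eventually_happens[of _ "at_right (0::real)"] by auto
  have "real n * (MIN s. E_o W z n \<rho> q1 s) \<le> real n * E_o W z n \<rho> q1 s0"
    by (intro mult_left_mono) auto
  then have "\<rho> * (?I1 - e / 2) + \<rho> * (?I2 - e / 2) - \<rho> * log 2 (real CARD('s))
      \<le> real (n + l) * E_o W z (n + l) \<rho> (concat_input n q1 q2) s0"
    using \<rho> E_o_concat_input[of \<rho> n l W z q1 s0 q2] n l by linarith
  also have "\<dots> \<le> \<rho> * directed_info W z (n + l) (concat_input n q1 q2) s0"
    using \<rho> n by (intro E_o_le_directed_info) auto
  finally have "\<rho> * (?I1 + ?I2 - log 2 (real CARD('s)) - e) \<le> \<rho> * directed_info W z (n + l) (concat_input n q1 q2) s0"
    by (simp add: algebra_simps)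
  then show "?I1 + ?I2 - log 2 (real CARD('s)) \<le> directed_info W z (n + l) (concat_input n q1 q2) s0 + e"
    using \<rho>(3) by simp
qed

lemma directed_info_le:
  fixes W :: "('x::finite, 'y::finite, 's::finite) kernel"
  assumes N: "N \<ge> 1"
  shows "directed_info W z N q s0 \<le> real N * log 2 (real CARD('y))"
proof (rule tendsto_upperbound[OF E_o_over_rho_tendsto[OF N]])
  have "\<forall>\<^sub>F \<rho> in at_right (0::real). \<rho> > 0" by (rule eventually_at_right_less)
  then show "\<forall>\<^sub>F \<rho> in at_right 0. real N * E_o W z N \<rho> q s0 / \<rho> \<le> real N * log 2 (real CARD('y))"
  proof eventually_elim
    case (elim \<rho>)
    have "real N * E_o W z N \<rho> q s0 \<le> real N * (\<rho> * log 2 (real CARD('y)))"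
      using elim N by (intro mult_left_mono E_o_le) auto
    then show ?case using elim by (simp add: field_simps)
  qed
qed simp

lemma Min_directed_info_le:
  fixes W :: "('x::finite, 'y::finite, 's::finite) kernel"
  assumes "N \<ge> 1"
  shows "(MIN s. directed_info W z N q s) \<le> real N * log 2 (real CARD('y))"
  by (rule order_trans[OF Min_le directed_info_le[OF assms, of W z q undefined]]) auto

text \<open>Subtracting \<open>log 2 CARD('s)\<close> once from the unnormalized capacity restores
  superadditivity, as for \<open>F_N\<close>; divided by n the correction tends to 0. The proof
  establishes the convergence on which the meaning of \<open>lim\<close> depends.\<close>

lemma C_lower_eq_SUP:
  fixes W :: "('x::finite, 'y::finite, 's::finite) kernel" and z :: "'y \<Rightarrow> 'z"
  defines "b \<equiv> \<lambda>n. real n * C_lower_N W z n - log 2 (real CARD('s))"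
  shows "bdd_above ((\<lambda>n. b n / real n) ` {1..})" "C_lower W z = (SUP n\<in>{1..}. b n / real n)"
proof -
  let ?S = "log 2 (real CARD('s))"
  let ?I = "\<lambda>n (q :: ('x, 'z) causal_input). MIN s. directed_info W z n q s"
  have S: "?S \<ge> 0" by (simp add: Suc_leI)
  have C: "real n * C_lower_N W z n = (SUP q. ?I n q)" if "n \<ge> 1" for n
    using that by (simp add: C_lower_N_def)
  have bddI: "bdd_above (range (?I n))" if "n \<ge> 1" for n
    using Min_directed_info_le[OF that] by (intro bdd_aboveI2)
  show bdd: "bdd_above ((\<lambda>n. b n / real n) ` {1..})"
  proof (intro bdd_aboveI2)
    fix n :: nat assume "n \<in> {1..}"
    then have n: "n \<ge> 1" by simp
    have "(SUP q. ?I n q) \<le> real n * log 2 (real CARD('y))"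
      using Min_directed_info_le[OF n] by (intro cSUP_least) auto
    then have "b n \<le> real n * log 2 (real CARD('y))" using S C[OF n] unfolding b_def by linarith
    then show "b n / real n \<le> log 2 (real CARD('y))" using n by (simp add: field_simps)
  qed
  have "b n + b l \<le> b (n + l)" if n: "n \<ge> 1" and l: "l \<ge> 1" for n l
  proof -
    have "1 * (SUP q. ?I n q) + 1 * (SUP q. ?I l q) \<le> (SUP q. ?I (n + l) q) + ?S"
    proof (rule SUP_add_SUP_le)
      fix q1 q2 :: "('x, 'z) causal_input"
      have "?I n q1 + ?I l q2 - ?S \<le> ?I (n + l) (concat_input n q1 q2)"
        using directed_info_concat_input[OF n l] by (subst Min_ge_iff) auto
      also have "\<dots> \<le> (SUP q. ?I (n + l) q)"
        using bddI[of "n + l"] n by (intro cSUP_upper) auto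
      finally show "1 * ?I n q1 + 1 * ?I l q2 \<le> (SUP q. ?I (n + l) q) + ?S" by simp
    qed auto
    then show ?thesis using C[OF n] C[OF l] C[of "n + l"] n by (simp add: b_def)
  qed
  then have "(\<lambda>n. b n / real n) \<longlonglongrightarrow> (SUP n\<in>{1..}. b n / real n)"
    using bdd by (intro superadditive_tendsto_SUP) auto
  moreover have "(\<lambda>n. ?S / real n) \<longlonglongrightarrow> 0" by (rule lim_const_over_n)
  ultimately have "(\<lambda>n. b n / real n + ?S / real n) \<longlonglongrightarrow> (SUP n\<in>{1..}. b n / real n) + 0"
    by (rule tendsto_add)
  moreover have "\<forall>\<^sub>F n in sequentially. b n / real n + ?S / real n = C_lower_N W z n"
    using eventually_gt_at_top[of 0] by eventually_elim (simp add: b_def field_simps)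
  ultimately have "C_lower_N W z \<longlonglongrightarrow> (SUP n\<in>{1..}. b n / real n)"
    by (simp add: Lim_transform_eventually)
  then show "C_lower W z = (SUP n\<in>{1..}. b n / real n)"
    unfolding C_lower_def by (rule limI)
qed

text \<open>The block length N, the input law q and \<rho> are chosen in this order, each depending
  on the previous ones; one block length already suffices, since \<open>F_inf\<close> dominates
  every \<open>F_N\<close>.\<close>

lemma E_r_pos:
  fixes W :: "('x::finite, 'y::finite, 's::finite) kernel"
  assumes R: "R \<ge> 0" "R < C_lower W z"
  shows "E_r W z R > 0"
proof -
  let ?S = "log 2 (real CARD('s))"
  obtain N where N: "N \<ge> 1" and "R < (real N * C_lower_N W z N - ?S) / real N"
    using R(2) C_lower_eq_SUP(1)[of W z] unfolding C_lower_eq_SUP(2)[of W z]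
    by (subst (asm) less_cSUP_iff) auto
  then have "real N * R + ?S < (SUP q. MIN s. directed_info W z N q s)"
    by (simp add: C_lower_N_def field_simps)
  then obtain q where q: "real N * R + ?S < (MIN s. directed_info W z N q s)"
    using Min_directed_info_le[OF N, of W z] by (subst (asm) less_cSUP_iff) (auto intro!: bdd_aboveI2)
  \<comment> \<open>Half of the gap: one half is spent on replacing the exponent by its
    linearization, the other keeps the final inequality strict.\<close>
  define e where "e = ((MIN s. directed_info W z N q s) - (real N * R + ?S)) / 2"
  have e: "e > 0" using q by (simp add: e_def)
  have "\<forall>\<^sub>F \<rho> in at_right 0. \<rho> * ((MIN s. directed_info W z N q s) - e) \<le> real N * (MIN s. E_o W z N \<rho> q s)
      \<and> \<rho> > 0 \<and> \<rho> < 1"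
    using e by (intro eventually_conj eventually_Min_E_o_ge N eventually_at_right_less eventually_at_right_real)
       (auto simp: eventually_at_right_field intro!: exI[of _ 1])
  then obtain \<rho> where \<rho>: "\<rho> * ((MIN s. directed_info W z N q s) - e) \<le> real N * (MIN s. E_o W z N \<rho> q s)"
      "\<rho> > 0" "\<rho> < 1"
    using eventually_happens[of _ "at_right (0::real)"] by auto
  have "(MIN s. E_o W z N \<rho> q s) \<le> (SUP q. MIN s. E_o W z N \<rho> q s)"
    using \<rho> N by (intro cSUP_upper bdd_above_Min_E_o) auto
  then have "real N * (MIN s. E_o W z N \<rho> q s) - \<rho> * ?S \<le> real N * F_N W z N \<rho>"
    using N by (simp add: F_N_def field_simps)
  moreover have "(MIN s. directed_info W z N q s) - e = real N * R + ?S + e" unfolding e_def by (simp add: field_simps)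
  ultimately have "\<rho> * (real N * R + e) \<le> real N * F_N W z N \<rho>"
    using \<rho>(1) by (simp add: algebra_simps)
  moreover have "\<rho> * e > 0" using \<rho> e by simp
  ultimately have "real N * (\<rho> * R) < real N * F_N W z N \<rho>"
    by (simp add: algebra_simps)
  then have "\<rho> * R < F_N W z N \<rho>" using N by simp
  also have "F_N W z N \<rho> \<le> F_inf W z \<rho>"
    unfolding F_inf_def using N \<rho> by (intro cSUP_upper bdd_above_F_N) auto
  finally have "0 < F_inf W z \<rho> - \<rho> * R" by simp
  also have "\<dots> \<le> E_r W z R"
    unfolding E_r_def using \<rho> by (intro cSUP_upper bdd_above_E_r R) auto
  finally show ?thesis .
qed

section \<open>Random code trees\<close>

text \<open>The letter at index i reads only the first i feedback symbols. The last symbol of zs is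
  therefore never read, and the full feedback of N outputs can be passed in place of N - 1.\<close>

definition codeword :: "('z list \<Rightarrow> 'x) \<Rightarrow> 'z list \<Rightarrow> 'x list" where
  "codeword e zs = map (\<lambda>i. e (take i zs)) [0..<length zs]"

lemma length_codeword [simp]: "length (codeword e zs) = length zs"
  by (simp add: codeword_def)

lemma causal_prob_deterministic:
  assumes "length xs = length zs"
  shows "causal_prob (\<lambda>xs zs. return_pmf (e zs)) xs zs = (if xs = codeword e zs then 1 else 0)"
proof (cases "xs = codeword e zs")
  case True
  then have "xs ! i = e (take i zs)" if "i < length xs" for i
    using that by (simp add: codeword_def)
  then have "causal_prob (\<lambda>xs zs. return_pmf (e zs)) xs zs = 1"
    unfolding causal_prob_def by (intro prod.neutral) simp
  then show ?thesis using True by simp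
next
  case False
  then obtain i where i: "i < length xs" "xs ! i \<noteq> codeword e zs ! i"
    using assms nth_equalityI[of xs "codeword e zs"] by auto
  then have "xs ! i \<noteq> e (take i zs)" using assms by (simp add: codeword_def)
  then have "pmf (return_pmf (e (take i zs))) (xs ! i) = 0" by simp
  then have "causal_prob (\<lambda>xs zs. return_pmf (e zs)) xs zs = 0"
    unfolding causal_prob_def using i(1) by (intro prod_zero finite_lessThan bexI[of _ i]) simp_all
  then show ?thesis using False by simp
qed

lemma error_prob_eq:
  fixes W :: "('x::finite, 'y::finite, 's::finite) kernel"
  shows "error_prob W z N enc dec m s0 =
    (\<Sum>ys | length ys = N \<and> dec ys \<noteq> m. channel_prob W s0 (codeword (\<lambda>zs. enc (length zs + 1) m zs) (map z ys)) ys)"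
proof -
  let ?e = "\<lambda>zs. enc (length zs + 1) m zs"
  let ?J = "joint_law W z (\<lambda>xs zs. return_pmf (?e zs)) s0 N"
  have "error_prob W z N enc dec m s0 = measure_pmf.prob ?J {(xs, ys). dec ys \<noteq> m}"
    by (simp add: error_prob_def joint_law_def vimage_def case_prod_beta')
  also have "\<dots> = measure_pmf.expectation ?J (indicator {(xs, ys). dec ys \<noteq> m})"
    by simp
  also have "\<dots> = (\<Sum>ys | length ys = N. if dec ys \<noteq> m then channel_prob W s0 (codeword ?e (map z ys)) ys else 0)"
    unfolding expectation_joint_law
  proof (intro sum.cong refl)
    fix ys :: "'y list" assume "ys \<in> {ys. length ys = N}"
    then have len: "length ys = N" by simp
    have "(\<Sum>xs | length xs = N. causal_prob (\<lambda>xs zs. return_pmf (?e zs)) xs (map z ys) * channel_prob W s0 xs ys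
        * indicator {(xs, ys). dec ys \<noteq> m} (xs, ys)) =
      (\<Sum>xs | length xs = N. if xs = codeword ?e (map z ys)
         then (if dec ys \<noteq> m then channel_prob W s0 (codeword ?e (map z ys)) ys else 0) else 0)"
      using len by (intro sum.cong) (auto simp: causal_prob_deterministic)
    also have "\<dots> = (if dec ys \<noteq> m then channel_prob W s0 (codeword ?e (map z ys)) ys else 0)"
      using len by (simp add: sum.delta')
    finally show "(\<Sum>xs | length xs = N. causal_prob (\<lambda>xs zs. return_pmf (?e zs)) xs (map z ys) * channel_prob W s0 xs ys
        * indicator {(xs, ys). dec ys \<noteq> m} (xs, ys)) = (if dec ys \<noteq> m then channel_prob W s0 (codeword ?e (map z ys)) ys else 0)" .
  qed
  also have "\<dots> = (\<Sum>ys | length ys = N \<and> dec ys \<noteq> m. channel_prob W s0 (codeword ?e (map z ys)) ys)"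
    using sum.inter_filter[of "{ys :: 'y list. length ys = N}"
        "\<lambda>ys. channel_prob W s0 (codeword ?e (map z ys)) ys" "\<lambda>ys. dec ys \<noteq> m"] by simp
  finally show ?thesis .
qed

text \<open>A table \<open>U\<close> proposes an input for every pair of past inputs and past feedback; following it
  along a feedback sequence gives a code tree. Entries drawn independently from \<open>q\<close> make the
  codeword along \<open>zs\<close> distributed as \<open>causal_prob q _ zs\<close>.\<close>

primrec tree_path :: "('x list \<times> 'z list \<Rightarrow> 'x) \<Rightarrow> 'z list \<Rightarrow> nat \<Rightarrow> 'x list" where
  "tree_path U zs 0 = []"
| "tree_path U zs (Suc k) = tree_path U zs k @ [U (tree_path U zs k, take k zs)]"

definition tree_strategy :: "('x list \<times> 'z list \<Rightarrow> 'x) \<Rightarrow> 'z list \<Rightarrow> 'x" where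
  "tree_strategy U zs = U (tree_path U zs (length zs), zs)"

lemma tree_path_take: "k \<le> j \<Longrightarrow> tree_path U (take j zs) k = tree_path U zs k"
  by (induction k) (auto simp: min_def)

lemma codeword_tree_strategy: "codeword (tree_strategy U) zs = tree_path U zs (length zs)"
proof -
  have "map (\<lambda>i. tree_strategy U (take i zs)) [0..<k] = tree_path U zs k" if "k \<le> length zs" for k
    using that by (induction k) (auto simp: tree_strategy_def tree_path_take min_def)
  then show ?thesis by (simp add: codeword_def)
qed

lemma tree_path_eq_iff:
  "k \<le> length xs \<Longrightarrow> tree_path U zs k = take k xs \<longleftrightarrow> (\<forall>i<k. U (take i xs, take i zs) = xs ! i)"
  by (induction k) (auto simp: take_Suc_conv_app_nth less_Suc_eq)

text \<open>A strategy may depend on feedback only, while q also depends on past inputs; the table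
  lets a path look up its own history. That the codeword along zs is xs fixes exactly the N table
  entries at the prefixes of (xs, zs). Their keys are distinct because their lengths differ, so
  independence gives the product.\<close>

lemma random_strategy_exists:
  fixes q :: "('x::finite, 'z::finite) causal_input"
  obtains \<mu> :: "('z list \<Rightarrow> 'x) pmf" where "finite (set_pmf \<mu>)"
    "\<And>xs zs. length xs = N \<Longrightarrow> length zs = N \<Longrightarrow> pmf (map_pmf (\<lambda>e. codeword e zs) \<mu>) xs = causal_prob q xs zs"
proof
  define A where "A = {xs :: 'x list. length xs \<le> N} \<times> {zs :: 'z list. length zs \<le> N}"
  have A: "finite A" unfolding A_def by (intro finite_cartesian_product finite_length_le)
  define p where "p = (\<lambda>(xs, zs). q xs zs)"
  define P where "P = Pi_pmf A undefined p"
  let ?\<mu> = "map_pmf tree_strategy P"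
  show "finite (set_pmf ?\<mu>)"
    using A by (auto simp: P_def set_Pi_pmf intro!: finite_imageI finite_PiE_dflt)
  fix xs :: "'x list" and zs :: "'z list" assume len: "length xs = N" "length zs = N"
  define K where "K i = (take i xs, take i zs)" for i
  have lenK: "length (fst (K i)) = i" if "i < N" for i using that len by (simp add: K_def)
  then have inj: "inj_on K {..<N}"
    by (intro inj_onI) (metis lessThan_iff)
  have KA: "K ` {..<N} \<subseteq> A" using len by (auto simp: K_def A_def)
  \<comment> \<open>A singleton at each of the N keys on the path and no constraint elsewhere, so
    that the event becomes a product set.\<close>
  define B where "B \<kappa> = (if \<kappa> \<in> K ` {..<N} then {xs ! length (fst \<kappa>)} else UNIV)" for \<kappa> :: "'x list \<times> 'z list"
  have BK: "B (K i) = {xs ! i}" if "i < N" for i using that lenK by (simp add: B_def)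
  have "(\<lambda>U. codeword (tree_strategy U) zs) -` {xs} = Pi A B"
  proof -
    have "codeword (tree_strategy U) zs = xs \<longleftrightarrow> (\<forall>i<N. U (K i) = xs ! i)" for U
      using tree_path_eq_iff[of N xs U zs] len by (simp add: codeword_tree_strategy K_def)
    moreover have "(\<forall>i<N. U (K i) = xs ! i) \<longleftrightarrow> U \<in> Pi A B" for U
    proof
      assume U: "\<forall>i<N. U (K i) = xs ! i"
      show "U \<in> Pi A B"
      proof
        fix \<kappa>
        show "U \<kappa> \<in> B \<kappa>"
        proof (cases "\<kappa> \<in> K ` {..<N}")
          case True
          then obtain i where "i < N" "\<kappa> = K i" by blast
          then show ?thesis using U BK by simp
        qed (simp add: B_def)
      qed
    next
      assume U: "U \<in> Pi A B"
      show "\<forall>i<N. U (K i) = xs ! i"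
      proof (intro allI impI)
        fix i assume i: "i < N"
        then have "U (K i) \<in> B (K i)" using U KA by (intro Pi_mem[OF U]) blast
        then show "U (K i) = xs ! i" using BK[OF i] by simp
      qed
    qed
    ultimately show ?thesis by blast
  qed
  then have "pmf (map_pmf (\<lambda>e. codeword e zs) ?\<mu>) xs = measure_pmf.prob P (Pi A B)"
    by (simp add: pmf.map_comp o_def pmf_map)
  also have "\<dots> = (\<Prod>\<kappa>\<in>A. measure_pmf.prob (p \<kappa>) (B \<kappa>))"
    unfolding P_def by (rule measure_Pi_pmf_Pi[OF A])
  also have "\<dots> = (\<Prod>\<kappa>\<in>K ` {..<N}. measure_pmf.prob (p \<kappa>) (B \<kappa>))"
    using KA by (intro prod.mono_neutral_right A) (auto simp: B_def)
  also have "\<dots> = (\<Prod>i<N. measure_pmf.prob (p (K i)) (B (K i)))"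
    using inj by (simp add: prod.reindex)
  also have "\<dots> = (\<Prod>i<N. pmf (q (take i xs) (take i zs)) (xs ! i))"
    by (intro prod.cong refl, simp only: lessThan_iff BK) (simp add: p_def K_def measure_pmf_single)
  finally show "pmf (map_pmf (\<lambda>e. codeword e zs) ?\<mu>) xs = causal_prob q xs zs"
    using len by (simp add: causal_prob_def)
qed

section \<open>Random coding\<close>

text \<open>Jensen for a concave power: integrate Young's inequality between \<open>f x\<close> and
  the mean c, then divide by \<open>c powr (1 - r)\<close>.\<close>

lemma expectation_powr_le:
  fixes f :: "'a \<Rightarrow> real"
  assumes fin: "finite (set_pmf p)" and f: "\<And>x. f x \<ge> 0" and r: "0 \<le> r" "r \<le> 1"
  shows "measure_pmf.expectation p (\<lambda>x. f x powr r) \<le> measure_pmf.expectation p f powr r"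
proof -
  define c where "c = measure_pmf.expectation p f"
  note int = integrable_measure_pmf_finite[OF fin]
  have c0: "c \<ge> 0" unfolding c_def using f by simp
  show ?thesis
  proof (cases "c = 0")
    case True
    then have "AE x in measure_pmf p. f x = 0"
      using f int unfolding c_def by (subst (asm) integral_nonneg_eq_0_iff_AE) auto
    then have "measure_pmf.expectation p (\<lambda>x. f x powr r) = measure_pmf.expectation p (\<lambda>x. 0)"
      by (intro integral_cong_AE) (auto elim: eventually_mono)
    then show ?thesis by simp
  next
    case False
    then have c: "c > 0" using c0 by simp
    have "f x powr r * c powr (1 - r) \<le> r * f x + (1 - r) * c" for x
    proof (cases "f x = 0")
      case False
      then have "f x > 0" using f[of x] by simp
      then show ?thesis using c r by (intro Youngs_inequality_0) auto
    qed (use c r in auto)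
    then have "measure_pmf.expectation p (\<lambda>x. f x powr r * c powr (1 - r))
        \<le> measure_pmf.expectation p (\<lambda>x. r * f x + (1 - r) * c)"
      by (intro integral_mono int) auto
    also have "\<dots> = r * c + (1 - r) * c" unfolding c_def by (simp add: int)
    also have "\<dots> = c powr r * c powr (1 - r)" using c by (simp add: algebra_simps flip: powr_add)
    finally show ?thesis using c by (simp add: c_def)
  qed
qed

lemma expectation_pair_pmf_mult:
  fixes g :: "'a \<Rightarrow> real" and h :: "'b \<Rightarrow> real"
  assumes fin: "finite (set_pmf p)" "finite (set_pmf p')"
  shows "measure_pmf.expectation (pair_pmf p p') (\<lambda>(x, y). g x * h y) =
    measure_pmf.expectation p g * measure_pmf.expectation p' h"
proof -
  have "measure_pmf.expectation (pair_pmf p p') (\<lambda>(x, y). g x * h y) =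
      (\<Sum>w\<in>set_pmf p \<times> set_pmf p'. (\<lambda>(x, y). g x * h y) w * pmf (pair_pmf p p') w)"
    using fin by (intro integral_measure_pmf_real) auto
  also have "\<dots> = (\<Sum>x\<in>set_pmf p. \<Sum>y\<in>set_pmf p'. (g x * pmf p x) * (h y * pmf p' y))"
    by (subst sum.cartesian_product) (auto simp: pmf_pair intro!: sum.cong)
  also have "\<dots> = (\<Sum>x\<in>set_pmf p. g x * pmf p x) * (\<Sum>y\<in>set_pmf p'. h y * pmf p' y)"
    by (simp add: sum_product)
  also have "\<dots> = measure_pmf.expectation p g * measure_pmf.expectation p' h"
    using fin by (simp add: integral_measure_pmf_real[of "set_pmf p"] integral_measure_pmf_real[of "set_pmf p'"])
  finally show ?thesis .
qed

text \<open>Split off coordinate m. By independence the expectation factors, and since \<rho> is at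
  most 1 concavity moves the power outside the expectation over the competitors.\<close>

lemma expectation_Pi_pmf_gallager:
  fixes a :: "'a \<Rightarrow> real"
  assumes fin: "finite (set_pmf \<mu>)" and I: "finite I" "m \<in> I" and a: "\<And>e. a e \<ge> 0" and \<rho>: "0 \<le> \<rho>" "\<rho> \<le> 1"
  shows "measure_pmf.expectation (Pi_pmf I d (\<lambda>_. \<mu>)) (\<lambda>e. a (e m) * (\<Sum>m'\<in>I - {m}. a (e m')) powr \<rho>)
    \<le> real (card I) powr \<rho> * measure_pmf.expectation \<mu> a powr (1 + \<rho>)"
proof -
  define A where "A = I - {m}"
  have A: "finite A" "m \<notin> A" "I = insert m A" using I by (auto simp: A_def)
  let ?P = "Pi_pmf A d (\<lambda>_. \<mu>)"
  define \<alpha> where "\<alpha> = measure_pmf.expectation \<mu> a"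
  have \<alpha>: "\<alpha> \<ge> 0" unfolding \<alpha>_def using a by simp
  have finP: "finite (set_pmf ?P)" using A fin by (auto simp: set_Pi_pmf)
  have upd: "(\<Sum>m'\<in>A. a ((f(m := x)) m')) = (\<Sum>m'\<in>A. a (f m'))" for f x
    using A by (intro sum.cong) auto
  have comp: "measure_pmf.expectation ?P (\<lambda>f. a (f m')) = \<alpha>" if "m' \<in> A" for m'
    using Pi_pmf_component[OF A(1), of m' d "\<lambda>_. \<mu>"] that integral_map_pmf[of "\<lambda>f. f m'" ?P a]
    by (simp add: \<alpha>_def)
  have "measure_pmf.expectation (Pi_pmf I d (\<lambda>_. \<mu>)) (\<lambda>e. a (e m) * (\<Sum>m'\<in>I - {m}. a (e m')) powr \<rho>)
      = measure_pmf.expectation (pair_pmf \<mu> ?P) (\<lambda>(x, f). a x * (\<Sum>m'\<in>A. a (f m')) powr \<rho>)"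
    unfolding A_def[symmetric] A(3) Pi_pmf_insert[OF A(1,2)] integral_map_pmf
    using A(2) by (simp add: case_prod_beta' upd del: fun_upd_apply) simp
  also have "\<dots> = \<alpha> * measure_pmf.expectation ?P (\<lambda>f. (\<Sum>m'\<in>A. a (f m')) powr \<rho>)"
    using expectation_pair_pmf_mult[OF fin finP] by (simp add: \<alpha>_def)
  also have "\<dots> \<le> \<alpha> * measure_pmf.expectation ?P (\<lambda>f. \<Sum>m'\<in>A. a (f m')) powr \<rho>"
    using \<alpha> a \<rho> by (intro mult_left_mono expectation_powr_le finP sum_nonneg) auto
  also have "measure_pmf.expectation ?P (\<lambda>f. \<Sum>m'\<in>A. a (f m')) = real (card A) * \<alpha>"
    by (subst Bochner_Integration.integral_sum) (auto simp: comp intro: integrable_measure_pmf_finite[OF finP])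
  \<comment> \<open>There are only \<open>card I - 1\<close> competitors; rounding up to
    \<open>card I\<close> gives the simpler bound.\<close>
  also have "\<alpha> * (real (card A) * \<alpha>) powr \<rho> \<le> \<alpha> * (real (card I) * \<alpha>) powr \<rho>"
    using \<alpha> \<rho> A I by (intro mult_left_mono powr_mono2 mult_right_mono) auto
  also have "\<dots> = real (card I) powr \<rho> * (\<alpha> * \<alpha> powr \<rho>)"
    using \<alpha> by (simp add: powr_mult)
  also have "\<alpha> * \<alpha> powr \<rho> = \<alpha> powr (1 + \<rho>)"
    using \<alpha> by (simp add: powr_mult_base)
  finally show ?thesis unfolding \<alpha>_def .
qed

text \<open>The metric P need only be nonnegative, not a probability: this permits the sum of the
  channel laws over all initial states.\<close>

lemma random_coding_average:
  fixes q :: "('x::finite, 'z::finite) causal_input" and P :: "'x list \<Rightarrow> 'y::finite list \<Rightarrow> real" and z :: "'y \<Rightarrow> 'z" and N :: nat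
  assumes P: "\<And>xs ys. P xs ys \<ge> 0" and \<rho>: "0 \<le> \<rho>" "\<rho> \<le> 1" and M: "M \<ge> 1"
  defines "G \<equiv> (\<Sum>ys | length ys = N. (\<Sum>xs | length xs = N.
     causal_prob q xs (map z ys) * P xs ys powr (1 / (1 + \<rho>))) powr (1 + \<rho>))"
  obtains e :: "nat \<Rightarrow> 'z list \<Rightarrow> 'x" and dec :: "'y list \<Rightarrow> nat" where "\<And>ys. dec ys \<in> {1..M}"
    "(\<Sum>m\<in>{1..M}. \<Sum>ys | length ys = N \<and> dec ys \<noteq> m. P (codeword (e m) (map z ys)) ys) \<le> real M * (real M powr \<rho> * G)"
proof -
  obtain \<mu> :: "('z list \<Rightarrow> 'x) pmf" where fin: "finite (set_pmf \<mu>)"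
    and \<mu>: "\<And>xs zs. length xs = N \<Longrightarrow> length zs = N \<Longrightarrow> pmf (map_pmf (\<lambda>e. codeword e zs) \<mu>) xs = causal_prob q xs zs"
    using random_strategy_exists[where N = N and q = q] by blast
  define a where "a ys e = P (codeword e (map z ys)) ys powr (1 / (1 + \<rho>))" for ys e
  have a0: "a ys e \<ge> 0" for ys e by (simp add: a_def)
  have Ea: "measure_pmf.expectation \<mu> (a ys) = (\<Sum>xs | length xs = N. causal_prob q xs (map z ys) * P xs ys powr (1 / (1 + \<rho>)))"
    if len: "length ys = N" for ys
  proof -
    have "measure_pmf.expectation \<mu> (a ys) =
        measure_pmf.expectation (map_pmf (\<lambda>e. codeword e (map z ys)) \<mu>) (\<lambda>xs. P xs ys powr (1 / (1 + \<rho>)))"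
      by (simp add: a_def[abs_def])
    also have "\<dots> = (\<Sum>xs | length xs = N. P xs ys powr (1 / (1 + \<rho>)) * pmf (map_pmf (\<lambda>e. codeword e (map z ys)) \<mu>) xs)"
      using len by (intro integral_measure_pmf_real) auto
    finally show ?thesis using len by (simp add: \<mu> mult.commute)
  qed
  define D where "D = Pi_pmf {1..M} undefined (\<lambda>_. \<mu>)"
  have finD: "finite (set_pmf D)" using fin by (auto simp: D_def set_Pi_pmf)
  note int = integrable_measure_pmf_finite[OF finD]
  \<comment> \<open>Gallager's bound on the total error, which no longer mentions the decoder and
    can be averaged over independent strategies.\<close>
  define f where "f e = (\<Sum>m\<in>{1..M}. \<Sum>ys | length ys = N. a ys (e m) * (\<Sum>m'\<in>{1..M} - {m}. a ys (e m')) powr \<rho>)" for e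
  have "measure_pmf.expectation D f = (\<Sum>m\<in>{1..M}. \<Sum>ys | length ys = N.
      measure_pmf.expectation D (\<lambda>e. a ys (e m) * (\<Sum>m'\<in>{1..M} - {m}. a ys (e m')) powr \<rho>))"
    unfolding f_def by (simp add: Bochner_Integration.integral_sum int)
  also have "\<dots> \<le> (\<Sum>m\<in>{1..M}. \<Sum>ys | length ys = N. real (card {1..M}) powr \<rho> * measure_pmf.expectation \<mu> (a ys) powr (1 + \<rho>))"
    unfolding D_def using fin a0 \<rho> by (intro sum_mono expectation_Pi_pmf_gallager) auto
  also have "\<dots> = real M * (real M powr \<rho> * G)"
    by (simp add: G_def Ea sum_distrib_left)
  finally have Ef: "measure_pmf.expectation D f \<le> real M * (real M powr \<rho> * G)" .
  have "\<exists>e. f e \<le> measure_pmf.expectation D f"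
  proof (rule ccontr)
    assume "\<not> (\<exists>e. f e \<le> measure_pmf.expectation D f)"
    then have "measure_pmf.expectation D f < f e" for e by (simp add: not_le)
    then have "measure_pmf.expectation D f < measure_pmf.expectation D f"
      by (intro measure_pmf.expectation_greater int) auto
    then show False by simp
  qed
  then obtain e where e: "f e \<le> measure_pmf.expectation D f" by blast
  define dec where "dec ys = arg_min_on (\<lambda>m. - P (codeword (e m) (map z ys)) ys) {1..M}" for ys
  have dec: "dec ys \<in> {1..M}" for ys
    unfolding dec_def using M by (intro arg_min_if_finite) auto
  have ml: "P (codeword (e m) (map z ys)) ys \<le> P (codeword (e (dec ys)) (map z ys)) ys" if "m \<in> {1..M}" for m ys
    using arg_min_if_finite(2)[of "{1..M}" "\<lambda>m. - P (codeword (e m) (map z ys)) ys"] that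
    unfolding dec_def by force
  \<comment> \<open>If m is not decoded, the decoded competitor has at least the same metric, so the
    sum over competitors dominates \<open>a ys (e m)\<close>; and P is the power 1 + \<rho> of
    a.\<close>
  have bound: "P (codeword (e m) (map z ys)) ys \<le> a ys (e m) * (\<Sum>m'\<in>{1..M} - {m}. a ys (e m')) powr \<rho>"
    if m: "m \<in> {1..M}" "dec ys \<noteq> m" for m ys
  proof -
    have "a ys (e m) \<le> a ys (e (dec ys))"
      unfolding a_def using ml[OF m(1)] P \<rho> by (intro powr_mono2) auto
    also have "\<dots> \<le> (\<Sum>m'\<in>{1..M} - {m}. a ys (e m'))"
      using dec[of ys] m a0 by (intro member_le_sum) auto
    finally have "a ys (e m) * a ys (e m) powr \<rho> \<le> a ys (e m) * (\<Sum>m'\<in>{1..M} - {m}. a ys (e m')) powr \<rho>"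
      using a0 \<rho> by (intro mult_left_mono powr_mono2) auto
    moreover have "a ys (e m) * a ys (e m) powr \<rho> = P (codeword (e m) (map z ys)) ys"
    proof -
      have "a ys (e m) * a ys (e m) powr \<rho> = a ys (e m) powr (1 + \<rho>)"
        using a0 by (simp add: powr_mult_base)
      also have "\<dots> = P (codeword (e m) (map z ys)) ys"
        using P \<rho> by (simp add: a_def powr_powr)
      finally show ?thesis .
    qed
    ultimately show ?thesis by simp
  qed
  have "(\<Sum>m\<in>{1..M}. \<Sum>ys | length ys = N \<and> dec ys \<noteq> m. P (codeword (e m) (map z ys)) ys)
      \<le> (\<Sum>m\<in>{1..M}. \<Sum>ys | length ys = N \<and> dec ys \<noteq> m. a ys (e m) * (\<Sum>m'\<in>{1..M} - {m}. a ys (e m')) powr \<rho>)"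
    by (intro sum_mono bound) auto
  also have "\<dots> \<le> f e"
    unfolding f_def using a0 by (intro sum_mono sum_mono2) auto
  also note e
  also note Ef
  finally show thesis by (rule that[OF dec])
qed

text \<open>Of \<open>2 * M\<close> random messages at least \<open>M\<close> have an error probability of at most twice the average.\<close>

lemma random_coding_maximal:
  fixes q :: "('x::finite, 'z::finite) causal_input" and P :: "'x list \<Rightarrow> 'y::finite list \<Rightarrow> real" and z :: "'y \<Rightarrow> 'z" and N :: nat
  assumes P: "\<And>xs ys. P xs ys \<ge> 0" and \<rho>: "0 \<le> \<rho>" "\<rho> \<le> 1" and M: "M \<ge> 1"
  defines "G \<equiv> (\<Sum>ys | length ys = N. (\<Sum>xs | length xs = N.
     causal_prob q xs (map z ys) * P xs ys powr (1 / (1 + \<rho>))) powr (1 + \<rho>))"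
  obtains e :: "nat \<Rightarrow> 'z list \<Rightarrow> 'x" and dec :: "'y list \<Rightarrow> nat" where "\<And>ys. dec ys \<in> {1..M}"
    "\<And>m. m \<in> {1..M} \<Longrightarrow> (\<Sum>ys | length ys = N \<and> dec ys \<noteq> m. P (codeword (e m) (map z ys)) ys)
       \<le> 2 * (real (2 * M) powr \<rho> * G)"
proof -
  have M2: "2 * M \<ge> 1" using M by simp
  obtain e :: "nat \<Rightarrow> 'z list \<Rightarrow> 'x" and dec :: "'y list \<Rightarrow> nat" where dec: "\<And>ys. dec ys \<in> {1..2 * M}"
    and avg: "(\<Sum>m\<in>{1..2 * M}. \<Sum>ys | length ys = N \<and> dec ys \<noteq> m. P (codeword (e m) (map z ys)) ys)
      \<le> real (2 * M) * (real (2 * M) powr \<rho> * G)"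
  proof (rule random_coding_average[where P = P and N = N and q = q and z = z, OF P \<rho> M2])
    fix e :: "nat \<Rightarrow> 'z list \<Rightarrow> 'x" and dec :: "'y list \<Rightarrow> nat"
    assume "\<And>ys. dec ys \<in> {1..2 * M}"
      "(\<Sum>m\<in>{1..2 * M}. \<Sum>ys | length ys = N \<and> dec ys \<noteq> m. P (codeword (e m) (map z ys)) ys)
        \<le> real (2 * M) * (real (2 * M) powr \<rho> * (\<Sum>ys | length ys = N. (\<Sum>xs | length xs = N.
     causal_prob q xs (map z ys) * P xs ys powr (1 / (1 + \<rho>))) powr (1 + \<rho>)))"
    then show thesis by (rule that[unfolded G_def])
  qed
  define err where "err m = (\<Sum>ys | length ys = N \<and> dec ys \<noteq> m. P (codeword (e m) (map z ys)) ys)" for m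
  define B where "B = real (2 * M) powr \<rho> * G"
  have B: "B \<ge> 0" unfolding B_def G_def by (intro mult_nonneg_nonneg sum_nonneg) auto
  have err0: "err m \<ge> 0" for m unfolding err_def using P by (intro sum_nonneg) auto
  define good where "good = {m \<in> {1..2 * M}. err m \<le> 2 * B}"
  define bad where "bad = {m \<in> {1..2 * M}. err m > 2 * B}"
  have cards: "card good + card bad = 2 * M"
  proof -
    have "good \<union> bad = {1..2 * M}" "good \<inter> bad = {}" by (auto simp: good_def bad_def)
    then show ?thesis using card_Un_disjoint[of good bad] by (simp add: good_def bad_def)
  qed
  have "M \<le> card good"
  proof (rule ccontr)
    assume "\<not> M \<le> card good"
    then have bad: "card bad \<ge> M + 1" using cards by simp
    then have ne: "bad \<noteq> {}" by auto
    \<comment> \<open>More than M messages above twice the average would by themselves exceed the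
      total of \<open>2 * M * B\<close>.\<close>
    have "real M * (2 * B) \<le> real (card bad) * (2 * B)" using bad B by (intro mult_right_mono) auto
    also have "\<dots> = (\<Sum>m\<in>bad. 2 * B)" by simp
    also have "\<dots> < (\<Sum>m\<in>bad. err m)" using ne by (intro sum_strict_mono) (auto simp: bad_def)
    also have "\<dots> \<le> (\<Sum>m\<in>{1..2 * M}. err m)" using err0 by (intro sum_mono2) (auto simp: bad_def)
    also have "\<dots> \<le> real (2 * M) * B" using avg by (simp add: err_def B_def)
    finally show False by simp
  qed
  then obtain T where T: "T \<subseteq> good" "card T = M" "finite T"
    by (metis obtain_subset_with_card_n)
  then obtain \<phi> where \<phi>: "bij_betw \<phi> {1..M} T"
    using finite_same_card_bij[of "{1..M}" T] by auto
  \<comment> \<open>Outputs decoded to a discarded message go to the default 1. Whatever was decoded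
    to a kept message still is, so no error event grows.\<close>
  define dec' where "dec' ys = (if dec ys \<in> T then inv_into {1..M} \<phi> (dec ys) else 1)" for ys
  show thesis
  proof
    show "dec' ys \<in> {1..M}" for ys
      using M \<phi> inv_into_into[of "dec ys" \<phi> "{1..M}"] by (auto simp: dec'_def bij_betw_def)
    fix m assume m: "m \<in> {1..M}"
    have "dec' ys = m" if "dec ys = \<phi> m" for ys
      using that m \<phi> by (auto simp: dec'_def bij_betw_def inv_into_f_f)
    then have sub: "{ys. length ys = N \<and> dec' ys \<noteq> m} \<subseteq> {ys. length ys = N \<and> dec ys \<noteq> \<phi> m}"
      by auto
    have "(\<Sum>ys | length ys = N \<and> dec' ys \<noteq> m. P (codeword ((e \<circ> \<phi>) m) (map z ys)) ys) \<le> err (\<phi> m)"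
      unfolding err_def o_def using sub P by (intro sum_mono2) auto
    also have "\<dots> \<le> 2 * B"
      using T m \<phi> by (auto simp: good_def bij_betw_def)
    finally show "(\<Sum>ys | length ys = N \<and> dec' ys \<noteq> m. P (codeword ((e \<circ> \<phi>) m) (map z ys)) ys)
       \<le> 2 * (real (2 * M) powr \<rho> * G)" by (simp add: B_def)
  qed
qed

text \<open>One code must serve all initial states. The summed metric dominates the channel law of
  each s0, so its error bound holds for all of them at once; separating the states again costs
  \<open>CARD('s) powr \<rho>\<close>.\<close>

lemma code_exists:
  fixes W :: "('x::finite, 'y::finite, 's::finite) kernel" and z :: "'y \<Rightarrow> 'z::finite"
  assumes \<rho>: "0 \<le> \<rho>" "\<rho> \<le> 1" and M: "M \<ge> 1"
  obtains enc dec where "is_decoder N M dec"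
    "\<And>m s0. m \<in> {1..M} \<Longrightarrow> error_prob W z N enc dec m s0 \<le>
       2 * (real (2 * M) powr \<rho> * (real CARD('s) powr \<rho> * (\<Sum>s\<in>UNIV. gallager_sum W z N \<rho> q s)))"
proof -
  define P where "P xs ys = (\<Sum>s\<in>UNIV. channel_prob W s xs ys)" for xs ys
  have P: "P xs ys \<ge> 0" for xs ys unfolding P_def by (intro sum_nonneg channel_prob_nonneg)
  define r where "r = 1 + \<rho>"
  have r: "r \<ge> 1" using \<rho> by (simp add: r_def)
  let ?G = "\<Sum>ys | length ys = N. (\<Sum>xs | length xs = N.
     causal_prob q xs (map z ys) * P xs ys powr (1 / (1 + \<rho>))) powr (1 + \<rho>)"
  obtain e :: "nat \<Rightarrow> 'z list \<Rightarrow> 'x" and dec :: "'y list \<Rightarrow> nat" where dec: "\<And>ys. dec ys \<in> {1..M}"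
    and err: "\<And>m. m \<in> {1..M} \<Longrightarrow> (\<Sum>ys | length ys = N \<and> dec ys \<noteq> m. P (codeword (e m) (map z ys)) ys)
       \<le> 2 * (real (2 * M) powr \<rho> * ?G)"
  proof (rule random_coding_maximal[where P = P and N = N and q = q and z = z, OF P \<rho> M])
    fix e :: "nat \<Rightarrow> 'z list \<Rightarrow> 'x" and dec :: "'y list \<Rightarrow> nat"
    assume "\<And>ys. dec ys \<in> {1..M}" "\<And>m. m \<in> {1..M} \<Longrightarrow>
      (\<Sum>ys | length ys = N \<and> dec ys \<noteq> m. P (codeword (e m) (map z ys)) ys) \<le> 2 * (real (2 * M) powr \<rho> * ?G)"
    then show thesis by (rule that)
  qed
  have "?G \<le> (\<Sum>ys | length ys = N. real CARD('s) powr \<rho> * (\<Sum>s\<in>UNIV. (\<Sum>xs | length xs = N.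
     causal_prob q xs (map z ys) * channel_prob W s xs ys powr (1 / (1 + \<rho>))) powr (1 + \<rho>)))"
  proof (rule sum_mono)
    fix ys :: "'y list"
    have "(\<Sum>xs | length xs = N. causal_prob q xs (map z ys) * P xs ys powr (1 / r))
        \<le> (\<Sum>xs | length xs = N. causal_prob q xs (map z ys) * (\<Sum>s\<in>UNIV. channel_prob W s xs ys powr (1 / r)))"
      unfolding P_def using r
      by (intro sum_mono mult_left_mono powr_sum_le) (auto simp: channel_prob_nonneg causal_prob_nonneg)
    also have "\<dots> = (\<Sum>s\<in>UNIV. \<Sum>xs | length xs = N. causal_prob q xs (map z ys) * channel_prob W s xs ys powr (1 / r))"
      unfolding sum_distrib_left by (rule sum.swap)
    finally have "(\<Sum>xs | length xs = N. causal_prob q xs (map z ys) * P xs ys powr (1 / r)) powr r \<le>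
        (\<Sum>s\<in>UNIV. \<Sum>xs | length xs = N. causal_prob q xs (map z ys) * channel_prob W s xs ys powr (1 / r)) powr r"
      using r by (intro powr_mono2 sum_nonneg) (auto simp: causal_prob_nonneg)
    also have "\<dots> \<le> real CARD('s) powr (r - 1) * (\<Sum>s\<in>UNIV. (\<Sum>xs | length xs = N.
        causal_prob q xs (map z ys) * channel_prob W s xs ys powr (1 / r)) powr r)"
      using r by (intro sum_powr_le) (auto intro!: sum_nonneg simp: causal_prob_nonneg)
    finally show "(\<Sum>xs | length xs = N. causal_prob q xs (map z ys) * P xs ys powr (1 / (1 + \<rho>))) powr (1 + \<rho>) \<le>
        real CARD('s) powr \<rho> * (\<Sum>s\<in>UNIV. (\<Sum>xs | length xs = N.
        causal_prob q xs (map z ys) * channel_prob W s xs ys powr (1 / (1 + \<rho>))) powr (1 + \<rho>))"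
      by (simp add: r_def)
  qed
  also have "\<dots> = real CARD('s) powr \<rho> * (\<Sum>s\<in>UNIV. gallager_sum W z N \<rho> q s)"
    unfolding gallager_sum_def sum_distrib_left[symmetric] by (subst sum.swap) simp
  finally have G: "?G \<le> real CARD('s) powr \<rho> * (\<Sum>s\<in>UNIV. gallager_sum W z N \<rho> q s)" .
  show thesis
  proof
    show "is_decoder N M dec" using dec by (simp add: is_decoder_def)
    fix m s0 assume m: "m \<in> {1..M}"
    have "error_prob W z N (\<lambda>_. e) dec m s0 = (\<Sum>ys | length ys = N \<and> dec ys \<noteq> m. channel_prob W s0 (codeword (e m) (map z ys)) ys)"
      by (simp add: error_prob_eq)
    also have "\<dots> \<le> (\<Sum>ys | length ys = N \<and> dec ys \<noteq> m. P (codeword (e m) (map z ys)) ys)"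
      unfolding P_def by (intro sum_mono member_le_sum) (auto simp: channel_prob_nonneg)
    also have "\<dots> \<le> 2 * (real (2 * M) powr \<rho> * ?G)" by (rule err[OF m])
    also have "\<dots> \<le> 2 * (real (2 * M) powr \<rho> * (real CARD('s) powr \<rho> * (\<Sum>s\<in>UNIV. gallager_sum W z N \<rho> q s)))"
      using G by (intro mult_left_mono) auto
    finally show "error_prob W z N (\<lambda>_. e) dec m s0 \<le>
       2 * (real (2 * M) powr \<rho> * (real CARD('s) powr \<rho> * (\<Sum>s\<in>UNIV. gallager_sum W z N \<rho> q s)))" .
  qed
qed

section \<open>The coding theorem\<close>

lemma num_messages_bounds:
  assumes "R \<ge> 0"
  shows "num_messages N R \<ge> 1" "real (num_messages N R) \<le> 2 * 2 powr (real N * R)"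
proof -
  have ge: "2 powr (real N * R) \<ge> 1" using assms by (simp add: ge_one_powr_ge_zero)
  define k where "k = \<lceil>2 powr (real N * R)\<rceil>"
  have k: "k \<ge> 1" "of_int k \<le> 2 powr (real N * R) + 1" using ge unfolding k_def by linarith+
  then show "num_messages N R \<ge> 1" unfolding num_messages_def k_def[symmetric] by arith
  show "real (num_messages N R) \<le> 2 * 2 powr (real N * R)"
    using k ge unfolding num_messages_def k_def[symmetric] by simp
qed

text \<open>The 8 is 2 from expurgation times 4: doubling the messages and rounding up to an integer
  give at most 4 times \<open>2 powr (N * R)\<close>, and \<rho> is at most 1. The factor
  \<open>CARD('s)\<close> counts the summed states, its power \<rho> cancels against the correction
  in \<open>F_N\<close>, and \<eta> is the slack of a near-optimal q.\<close>

lemma code_error_bound: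
  fixes W :: "('x::finite, 'y::finite, 's::finite) kernel" and z :: "'y \<Rightarrow> 'z::finite"
  assumes R: "R \<ge> 0" and \<rho>: "0 \<le> \<rho>" "\<rho> \<le> 1" and N: "N \<ge> 1" and \<eta>: "\<eta> > 0"
  obtains enc dec where "is_decoder N (num_messages N R) dec"
    "\<And>m s0. m \<in> {1..num_messages N R} \<Longrightarrow> error_prob W z N enc dec m s0 \<le>
       8 * real CARD('s) * 2 powr (- real N * (F_N W z N \<rho> - \<rho> * R - \<eta>))"
proof -
  let ?S = "real CARD('s)" and ?M = "num_messages N R"
  have S: "?S > 0" by simp
  have "(SUP q. MIN s0. E_o W z N \<rho> q s0) - \<eta> < (SUP q. MIN s0. E_o W z N \<rho> q s0)" using \<eta> by simp
  then obtain q :: "('x, 'z) causal_input" where q: "(SUP q. MIN s0. E_o W z N \<rho> q s0) - \<eta> < (MIN s0. E_o W z N \<rho> q s0)"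
    using bdd_above_Min_E_o[OF \<rho>(1) N, of W z] by (subst (asm) less_cSUP_iff) auto
  define F where "F = F_N W z N \<rho>"
  have "real N * (F - \<eta>) + \<rho> * log 2 ?S \<le> real N * E_o W z N \<rho> q s" for s
  proof -
    have "F - \<eta> + \<rho> * log 2 ?S / real N \<le> (MIN s0. E_o W z N \<rho> q s0)"
      using q unfolding F_def F_N_def by linarith
    also have "\<dots> \<le> E_o W z N \<rho> q s" by simp
    finally show ?thesis using N by (simp add: field_simps)
  qed
  then have "gallager_sum W z N \<rho> q s \<le> 2 powr (- real N * (F - \<eta>) - \<rho> * log 2 ?S)" for s
    unfolding gallager_sum_E_o[OF \<rho>(1) N] by (intro powr_mono) (auto simp: algebra_simps)
  then have "(\<Sum>s\<in>UNIV. gallager_sum W z N \<rho> q s) \<le> (\<Sum>s\<in>(UNIV :: 's set). 2 powr (- real N * (F - \<eta>) - \<rho> * log 2 ?S))"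
    by (intro sum_mono)
  also have "\<dots> = ?S * 2 powr (- real N * (F - \<eta>)) / ?S powr \<rho>"
    using S by (simp add: powr_diff powr_powr[symmetric] mult.commute[of \<rho>])
  finally have G: "?S powr \<rho> * (\<Sum>s\<in>UNIV. gallager_sum W z N \<rho> q s) \<le> ?S * 2 powr (- real N * (F - \<eta>))"
    using S by (simp add: field_simps)
  have "real (2 * ?M) powr \<rho> \<le> (4 * 2 powr (real N * R)) powr \<rho>"
    using num_messages_bounds(2)[OF R, of N] \<rho> by (intro powr_mono2) auto
  also have "\<dots> = 4 powr \<rho> * 2 powr (real N * (\<rho> * R))"
    by (simp add: powr_mult powr_powr mult_ac)
  also have "\<dots> \<le> 4 powr 1 * 2 powr (real N * (\<rho> * R))"
    using \<rho> by (intro mult_right_mono powr_mono) auto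
  finally have M: "real (2 * ?M) powr \<rho> \<le> 4 * 2 powr (real N * (\<rho> * R))" by simp
  have "2 * (real (2 * ?M) powr \<rho> * (?S powr \<rho> * (\<Sum>s\<in>UNIV. gallager_sum W z N \<rho> q s)))
      \<le> 2 * ((4 * 2 powr (real N * (\<rho> * R))) * (?S * 2 powr (- real N * (F - \<eta>))))"
    by (rule mult_left_mono[OF mult_mono[OF M G]]) (auto intro!: sum_nonneg mult_nonneg_nonneg simp: gallager_sum_nonneg)
  also have "\<dots> = 8 * ?S * (2 powr (real N * (\<rho> * R)) * 2 powr (- real N * (F - \<eta>)))"
    by simp
  also have "2 powr (real N * (\<rho> * R)) * 2 powr (- real N * (F - \<eta>)) = 2 powr (- real N * (F - \<rho> * R - \<eta>))"
    by (simp add: powr_add[symmetric] algebra_simps)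
  finally have bound: "2 * (real (2 * ?M) powr \<rho> * (?S powr \<rho> * (\<Sum>s\<in>UNIV. gallager_sum W z N \<rho> q s)))
      \<le> 8 * ?S * 2 powr (- real N * (F - \<rho> * R - \<eta>))" .
  show thesis
  proof (rule code_exists[OF \<rho> num_messages_bounds(1)[OF R, of N], of N W z q])
    fix enc :: "nat \<Rightarrow> nat \<Rightarrow> 'z list \<Rightarrow> 'x" and dec :: "'y list \<Rightarrow> nat"
    assume dec: "is_decoder N ?M dec"
      and err: "\<And>m s0. m \<in> {1..?M} \<Longrightarrow> error_prob W z N enc dec m s0 \<le>
         2 * (real (2 * ?M) powr \<rho> * (?S powr \<rho> * (\<Sum>s\<in>UNIV. gallager_sum W z N \<rho> q s)))"
    show thesis
      using order_trans[OF err bound] by (intro that[OF dec]) (auto simp: F_def)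
  qed
qed

text \<open>Each quarter of \<epsilon> has one use: near-optimality of \<rho>, the distance of
  \<open>F_N\<close> from its limit, the slack for the input law, and the constant
  \<open>8 * CARD('s)\<close>.\<close>

lemma codes_attaining_E_r:
  fixes W :: "('x::finite, 'y::finite, 's::finite) kernel" and z :: "'y \<Rightarrow> 'z::finite"
  assumes R: "R \<ge> 0" and \<epsilon>: "\<epsilon> > 0"
  shows "\<exists>N\<^sub>0. \<forall>N\<ge>N\<^sub>0. \<exists>enc dec. is_decoder N (num_messages N R) dec \<and>
    (\<forall>m\<in>{1..num_messages N R}. \<forall>s0. error_prob W z N enc dec m s0 \<le> 2 powr (- real N * (E_r W z R - \<epsilon>)))"
proof -
  let ?S = "real CARD('s)"
  have "E_r W z R - \<epsilon> / 4 < E_r W z R" using \<epsilon> by simp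
  then obtain \<rho> where \<rho>: "0 \<le> \<rho>" "\<rho> \<le> 1" and Er: "E_r W z R - \<epsilon> / 4 < F_inf W z \<rho> - \<rho> * R"
    using bdd_above_E_r[OF R, of W z] unfolding E_r_def by (subst (asm) less_cSUP_iff) auto
  have "F_inf W z \<rho> - \<epsilon> / 4 < F_inf W z \<rho>" using \<epsilon> by simp
  then have "\<forall>\<^sub>F N in sequentially. F_inf W z \<rho> - \<epsilon> / 4 < F_N W z N \<rho>"
    by (rule order_tendstoD(1)[OF F_N_tendsto_F_inf[OF \<rho>(1)]])
  moreover have "\<forall>\<^sub>F N in sequentially. log 2 (8 * ?S) / (\<epsilon> / 4) \<le> real N"
    using filterlim_real_sequentially by (simp add: filterlim_at_top)
  ultimately have "\<forall>\<^sub>F N in sequentially. F_inf W z \<rho> - \<epsilon> / 4 < F_N W z N \<rho> \<and>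
      log 2 (8 * ?S) / (\<epsilon> / 4) \<le> real N \<and> N \<ge> 1"
    using eventually_ge_at_top[of 1] by eventually_elim auto
  then obtain N\<^sub>0 where N\<^sub>0: "\<And>N. N \<ge> N\<^sub>0 \<Longrightarrow> F_inf W z \<rho> - \<epsilon> / 4 < F_N W z N \<rho> \<and>
      log 2 (8 * ?S) / (\<epsilon> / 4) \<le> real N \<and> N \<ge> 1"
    unfolding eventually_sequentially by blast
  show ?thesis
  proof (intro exI[of _ N\<^sub>0] allI impI)
    fix N assume "N \<ge> N\<^sub>0"
    then have F: "F_inf W z \<rho> - \<epsilon> / 4 < F_N W z N \<rho>" and large: "log 2 (8 * ?S) / (\<epsilon> / 4) \<le> real N" and N: "N \<ge> 1"
      using N\<^sub>0 by auto
    have "8 * ?S = 2 powr (log 2 (8 * ?S))" by simp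
    also have "\<dots> \<le> 2 powr (real N * (\<epsilon> / 4))"
      using large \<epsilon> by (intro powr_mono) (auto simp: field_simps)
    finally have S: "8 * ?S \<le> 2 powr (real N * (\<epsilon> / 4))" .
    have expo: "real N * (E_r W z R - 3 * (\<epsilon> / 4)) \<le> real N * (F_N W z N \<rho> - \<rho> * R - \<epsilon> / 4)"
      using F Er by (intro mult_left_mono) linarith+
    have "8 * ?S * 2 powr (- real N * (F_N W z N \<rho> - \<rho> * R - \<epsilon> / 4))
        \<le> 2 powr (real N * (\<epsilon> / 4)) * 2 powr (- real N * (E_r W z R - 3 * (\<epsilon> / 4)))"
      by (rule mult_mono[OF S powr_mono]) (use expo in auto)
    also have "\<dots> = 2 powr (- real N * (E_r W z R - \<epsilon>))"
      by (simp add: powr_add[symmetric] algebra_simps)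
    finally have bound: "8 * ?S * 2 powr (- real N * (F_N W z N \<rho> - \<rho> * R - \<epsilon> / 4)) \<le> 2 powr (- real N * (E_r W z R - \<epsilon>))" .
    have "\<epsilon> / 4 > 0" using \<epsilon> by simp
    from code_error_bound[OF R \<rho> N this, of W z]
    show "\<exists>enc dec. is_decoder N (num_messages N R) dec \<and>
      (\<forall>m\<in>{1..num_messages N R}. \<forall>s0. error_prob W z N enc dec m s0 \<le> 2 powr (- real N * (E_r W z R - \<epsilon>)))"
      using order_trans[OF _ bound] by metis
  qed
qed

theorem theorem14:
  fixes W :: "'x::finite \<Rightarrow> 's::finite \<Rightarrow> ('y::finite \<times> 's) pmf"
    and z :: "'y \<Rightarrow> 'z::finite"
    and R :: real
  assumes "R \<ge> 0"
  shows "(\<forall>\<epsilon>>0. \<exists>N\<^sub>0. \<forall>N\<ge>N\<^sub>0. \<exists>enc dec.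
            is_decoder N (num_messages N R) dec \<and>
            (\<forall>m\<in>{1..num_messages N R}. \<forall>s0.
               error_prob W z N enc dec m s0 \<le> 2 powr (- real N * (E_r W z R - \<epsilon>))))
       \<and> (R < C_lower W z \<longrightarrow>
            E_r W z R > 0 \<and>
            (\<forall>\<delta>>0. \<exists>N\<^sub>0. \<forall>N\<ge>N\<^sub>0. \<exists>enc dec.
               is_decoder N (num_messages N R) dec \<and>
               (\<forall>m\<in>{1..num_messages N R}. \<forall>s0. error_prob W z N enc dec m s0 \<le> \<delta>)))"
proof (intro conjI allI impI)
  fix \<epsilon> :: real assume "\<epsilon> > 0"
  then show "\<exists>N\<^sub>0. \<forall>N\<ge>N\<^sub>0. \<exists>enc dec. is_decoder N (num_messages N R) dec \<and>
    (\<forall>m\<in>{1..num_messages N R}. \<forall>s0. error_prob W z N enc dec m s0 \<le> 2 powr (- real N * (E_r W z R - \<epsilon>)))"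
    by (rule codes_attaining_E_r[OF assms])
next
  assume "R < C_lower W z"
  then show "E_r W z R > 0" by (rule E_r_pos[OF assms])
next
  fix \<delta> :: real assume RC: "R < C_lower W z" and \<delta>: "\<delta> > 0"
  \<comment> \<open>Half of the exponent is given away; the other half, again \<epsilon>, drives the
    error to 0.\<close>
  define \<epsilon> where "\<epsilon> = E_r W z R / 2"
  have \<epsilon>: "\<epsilon> > 0" using E_r_pos[OF assms RC] by (simp add: \<epsilon>_def)
  obtain N\<^sub>1 where N\<^sub>1: "\<And>N. N \<ge> N\<^sub>1 \<Longrightarrow> \<exists>enc dec. is_decoder N (num_messages N R) dec \<and>
    (\<forall>m\<in>{1..num_messages N R}. \<forall>s0. error_prob W z N enc dec m s0 \<le> 2 powr (- real N * (E_r W z R - \<epsilon>)))"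
    using codes_attaining_E_r[OF assms \<epsilon>, of W z] by blast
  obtain N\<^sub>2 :: nat where N\<^sub>2: "real N\<^sub>2 \<ge> - log 2 \<delta> / \<epsilon>" using real_arch_simple by blast
  have small: "2 powr (- real N * (E_r W z R - \<epsilon>)) \<le> \<delta>" if "N \<ge> N\<^sub>2" for N
  proof -
    have "- log 2 \<delta> / \<epsilon> \<le> real N" using N\<^sub>2 that by linarith
    then have "- real N * \<epsilon> \<le> log 2 \<delta>" using \<epsilon> by (simp add: field_simps)
    then have "2 powr (- real N * \<epsilon>) \<le> 2 powr (log 2 \<delta>)" by (intro powr_mono) auto
    then show ?thesis using \<delta> by (simp add: \<epsilon>_def)
  qed
  show "\<exists>N\<^sub>0. \<forall>N\<ge>N\<^sub>0. \<exists>enc dec. is_decoder N (num_messages N R) dec \<and>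
    (\<forall>m\<in>{1..num_messages N R}. \<forall>s0. error_prob W z N enc dec m s0 \<le> \<delta>)"
  proof (intro exI[of _ "max N\<^sub>1 N\<^sub>2"] allI impI)
    fix N assume N: "N \<ge> max N\<^sub>1 N\<^sub>2"
    then have "N \<ge> N\<^sub>1" and le: "2 powr (- real N * (E_r W z R - \<epsilon>)) \<le> \<delta>" using small[of N] by auto
    from N\<^sub>1[OF this(1)] obtain enc dec where dec: "is_decoder N (num_messages N R) dec"
      and err: "\<forall>m\<in>{1..num_messages N R}. \<forall>s0. error_prob W z N enc dec m s0 \<le> 2 powr (- real N * (E_r W z R - \<epsilon>))"
      by blast
    show "\<exists>enc dec. is_decoder N (num_messages N R) dec \<and>
      (\<forall>m\<in>{1..num_messages N R}. \<forall>s0. error_prob W z N enc dec m s0 \<le> \<delta>)"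
      using dec err by (intro exI[of _ enc] exI[of _ dec]) (auto intro: order_trans[OF _ le])
  qed
qed

end
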